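(* Let $n\ge 2$, let $\Pi_0,\dots,\Pi_n\subset\mathbb{P}^n$ be general linear subspaces of codimension $2$, let $R_n=Q_0\cap\dots\cap Q_n$, and let $B_n$ be the base locus of the rational map $v_n$. Then $B_n=\Pi_0\cup\dots\cup\Pi_n\cup R_n$.
   Context: $\mathbb{P}^n$ is projective space over a ground field $K$ of characteristic $0$; points and lines are understood geometrically (i.e. over an algebraic closure if $K$ is not algebraically closed). "General" means: for all choices in some dense Zariski-open subset of the parameter space. For each $j=0,\dots,n$ there is a unique hypersurface of degree $n-1$ in $\mathbb{P}^n$ containing the $n$ subspaces $\Pi_i$, $i\neq j$; it is denoted $Q_j$. $\mathcal{L}_n$ is the linear system (vector space) of forms of degree $n$ vanishing on $\Pi_0\cup\dots\cup\Pi_n$; it has vector space dimension $n+1$, and $v_n:\mathbb{P}^n\dashrightarrow\mathbb{P}^n$ is the rational map given by $\mathcal{L}_n$. Its base locus is the set of common zeros of all forms in $\mathcal{L}_n$. *)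

theory Defs
  imports
    "HOL-Algebra.Algebraic_Closure_Type"
    "HOL-Library.Poly_Mapping"
    "HOL-Library.FuncSet"
    "Jordan_Normal_Form.DL_Rank"
    "Jordan_Normal_Form.Matrix_Kernel"
begin

section \<open>Polynomials in several variables\<close>

type_synonym ('v, 'a) mpol = "('v \<Rightarrow>\<^sub>0 nat) \<Rightarrow>\<^sub>0 'a"

text \<open>The coefficients are transported along \<open>h\<close>, so that a polynomial over a field can be
  evaluated at a point with coordinates in an extension field.\<close>

definition mpol_eval :: "('a::comm_ring_1 \<Rightarrow> 'b::comm_ring_1) \<Rightarrow> ('v \<Rightarrow> 'b) \<Rightarrow> ('v, 'a) mpol \<Rightarrow> 'b" where
  "mpol_eval h x f =
     (\<Sum>m\<in>Poly_Mapping.keys f. h (Poly_Mapping.lookup f m) *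
        (\<Prod>v\<in>Poly_Mapping.keys m. x v ^ Poly_Mapping.lookup m v))"

definition mpols_in :: "'v set \<Rightarrow> ('v, 'a::comm_ring_1) mpol set" where
  "mpols_in V = {f. \<forall>m\<in>Poly_Mapping.keys f. Poly_Mapping.keys m \<subseteq> V}"

text \<open>Homogeneous polynomials of degree \<open>d\<close> (including \<open>0\<close>) in the coordinates
  \<open>x\<^sub>0, \<dots>, x\<^sub>n\<close>.\<close>

definition forms :: "nat \<Rightarrow> nat \<Rightarrow> (nat, 'k::field) mpol set" where
  "forms n d = {f \<in> mpols_in {..n}. \<forall>m\<in>Poly_Mapping.keys f.
      (\<Sum>v\<in>Poly_Mapping.keys m. Poly_Mapping.lookup m v) = d}"


section \<open>Geometric points of projective space over a field \<open>'k\<close>\<close>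

text \<open>A point is the class of a nonzero vector of length \<open>n + 1\<close> over the algebraic closure,
  up to nonzero scalars. The ground field can be read off from the type \<open>'k alg_closure\<close>.\<close>

type_synonym 'k pt = "'k alg_closure vec set"

definition proj_pt :: "'k::field alg_closure vec \<Rightarrow> 'k pt" where
  "proj_pt x = {c \<cdot>\<^sub>v x | c. c \<noteq> 0}"

definition proj_space :: "nat \<Rightarrow> 'k::field pt set" where
  "proj_space n = proj_pt ` {x \<in> carrier_vec (Suc n). x \<noteq> 0\<^sub>v (Suc n)}"

definition vanishes_at :: "(nat, 'k::field) mpol \<Rightarrow> 'k pt \<Rightarrow> bool" where
  "vanishes_at f p \<longleftrightarrow> (\<forall>x\<in>p. mpol_eval to_ac (\<lambda>i. x $ i) f = 0)"

definition vanishes_on :: "(nat, 'k::field) mpol \<Rightarrow> 'k pt set \<Rightarrow> bool" where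
  "vanishes_on f Z \<longleftrightarrow> (\<forall>p\<in>Z. vanishes_at f p)"


section \<open>Linear subspaces of codimension two and their parameter space\<close>

text \<open>The rows of a frame are the coefficient vectors of two independent linear forms over
  the ground field.\<close>

definition frames2 :: "nat \<Rightarrow> 'k::field mat set" where
  "frames2 n = {A \<in> carrier_mat 2 (Suc n). vec_space.rank 2 A = 2}"

definition lin_subspace :: "nat \<Rightarrow> 'k::field mat \<Rightarrow> 'k pt set" where
  "lin_subspace n A = {p \<in> proj_space n. p \<subseteq> mat_kernel (map_mat to_ac A)}"

definition codim2_subspaces :: "nat \<Rightarrow> 'k::field pt set set" where
  "codim2_subspaces n = lin_subspace n ` frames2 n"

text \<open>Families \<open>\<Pi>\<^sub>0, \<dots>, \<Pi>\<^sub>n\<close>: the rational points of the \<open>(n+1)\<close>-fold product of the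
  Grassmannian of codimension two subspaces.\<close>

definition configs :: "nat \<Rightarrow> (nat \<Rightarrow> 'k::field pt set) set" where
  "configs n = {..n} \<rightarrow>\<^sub>E codim2_subspaces n"

definition config_frames :: "nat \<Rightarrow> (nat \<Rightarrow> 'k::field mat) set" where
  "config_frames n = {..n} \<rightarrow>\<^sub>E frames2 n"

definition config_of :: "nat \<Rightarrow> (nat \<Rightarrow> 'k::field mat) \<Rightarrow> (nat \<Rightarrow> 'k pt set)" where
  "config_of n A = (\<lambda>i\<in>{..n}. lin_subspace n (A i))"

text \<open>The product of Grassmannians carries the quotient topology of the space of frames, which
  is a Zariski-open part of an affine space with coordinates \<open>(i, r, c)\<close> (the entry in row
  \<open>r\<close>, column \<open>c\<close> of the \<open>i\<close>-th frame): a set is open iff its preimage is the complement, in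
  the space of frames, of the zero set of a family of polynomials over the ground field.\<close>

definition zariski_open :: "nat \<Rightarrow> (nat \<Rightarrow> 'k::field pt set) set \<Rightarrow> bool" where
  "zariski_open n U \<longleftrightarrow> U \<subseteq> configs n \<and>
     (\<exists>G :: (nat \<times> nat \<times> nat, 'k) mpol set. G \<subseteq> mpols_in ({..n} \<times> {..<2} \<times> {..n}) \<and>
        {A \<in> config_frames n. config_of n A \<in> U} =
        {A \<in> config_frames n. \<exists>g\<in>G. mpol_eval id (\<lambda>(i, r, c). A i $$ (r, c)) g \<noteq> 0})"

definition zariski_dense :: "nat \<Rightarrow> (nat \<Rightarrow> 'k::field pt set) set \<Rightarrow> bool" where
  "zariski_dense n U \<longleftrightarrow> (\<forall>W. zariski_open n W \<and> W \<noteq> {} \<longrightarrow> U \<inter> W \<noteq> {})"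


section \<open>The hypersurfaces \<open>Q\<^sub>j\<close>, the linear system and its base locus\<close>

text \<open>A hypersurface of degree \<open>d\<close> over the ground field is the class of a nonzero form of
  degree \<open>d\<close> up to nonzero scalars, so multiplicities of components count; \<open>support\<close> is its
  set of geometric points.\<close>

definition hypersurfaces :: "nat \<Rightarrow> nat \<Rightarrow> (nat, 'k::field) mpol set set" where
  "hypersurfaces n d =
     (\<lambda>f. {Poly_Mapping.map (\<lambda>a. c * a) f | c. c \<noteq> 0}) ` {f \<in> forms n d. f \<noteq> 0}"

definition support :: "nat \<Rightarrow> (nat, 'k::field) mpol set \<Rightarrow> 'k pt set" where
  "support n H = {p \<in> proj_space n. \<forall>f\<in>H. vanishes_at f p}"

text \<open>Only meaningful if there is exactly one such hypersurface, as is the case for general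
  \<open>\<Pi>\<close>.\<close>

definition Q_hyp :: "nat \<Rightarrow> (nat \<Rightarrow> 'k::field pt set) \<Rightarrow> nat \<Rightarrow> (nat, 'k) mpol set" where
  "Q_hyp n P j =
     (THE H. H \<in> hypersurfaces n (n - 1) \<and> (\<forall>i\<le>n. i \<noteq> j \<longrightarrow> P i \<subseteq> support n H))"

definition R_locus :: "nat \<Rightarrow> (nat \<Rightarrow> 'k::field pt set) \<Rightarrow> 'k pt set" where
  "R_locus n P = (\<Inter>j\<le>n. support n (Q_hyp n P j))"

definition lin_system :: "nat \<Rightarrow> (nat \<Rightarrow> 'k::field pt set) \<Rightarrow> (nat, 'k) mpol set" where
  "lin_system n P = {f \<in> forms n n. vanishes_on f (\<Union>i\<le>n. P i)}"

definition base_locus :: "nat \<Rightarrow> (nat \<Rightarrow> 'k::field pt set) \<Rightarrow> 'k pt set" where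
  "base_locus n P = {p \<in> proj_space n. \<forall>f\<in>lin_system n P. vanishes_at f p}"

end

theory Submission
  imports Defs
begin

text \<open>
  Let \<open>\<Pi>\<^sub>i\<close> be the common zeros of linear forms \<open>a\<^sub>i\<close> and \<open>b\<^sub>i\<close>. For general \<open>\<Pi>\<^sub>i\<close> the \<open>a\<^sub>i\<close> can be used as
  coordinates \<open>y\<^sub>i\<close>, and \<open>b\<^sub>i = \<Sum>\<^sub>k B\<^sub>i\<^sub>k y\<^sub>k\<close> for a matrix \<open>B\<close> that is generic in the sense of
  \<open>generic_matrix\<close>. The proof rests on two facts about this situation.

  First, a form of degree \<open>n\<close> that vanishes on all \<open>\<Pi>\<^sub>i\<close> and at the vertices of the coordinate simplex
  is zero (\<open>hom_funs_eq_0_of_generic\<close>). On the hyperplane \<open>y\<^sub>i = 0\<close> it is a multiple of \<open>b\<^sub>i\<close>, and the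
  quotient is zero by induction on \<open>n\<close>. So the form is divisible by all \<open>n + 1\<close> coordinates, although
  its degree is \<open>n\<close>.

  Second, an explicit determinant \<open>q\<^sub>j\<close> of degree \<open>n - 1\<close> vanishes on \<open>\<Pi>\<^sub>i\<close> for \<open>i \<noteq> j\<close> and
  is nonzero at the \<open>j\<close>-th vertex (\<open>tree_matrix\<close>). Geometrically its zeros are swept out by the lines
  meeting all these \<open>\<Pi>\<^sub>i\<close>.

  The products \<open>y\<^sub>j q\<^sub>j\<close> lie in the linear system and separate the vertices. Subtracting
  a combination of them from an arbitrary member of the system and applying the first fact shows that they
  span the system (\<open>eval_eq_sum_Q_form\<close>). If a form \<open>f\<close> of degree \<open>n - 1\<close> vanishes on all \<open>\<Pi>\<^sub>i\<close> with
  \<open>i \<noteq> j\<close>, the same argument for \<open>y\<^sub>j f\<close> shows that it is a multiple of \<open>q\<^sub>j\<close>; thus \<open>Q\<^sub>j\<close> is well defined and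
  \<open>q\<^sub>j = 0\<close> is its equation (\<open>form_eq_multiple_Q_form\<close>).

  Now both inclusions are easy. All members of the system vanish where all \<open>q\<^sub>j\<close> vanish. If \<open>p\<close> is a
  base point outside all \<open>\<Pi>\<^sub>j\<close>, then \<open>q\<^sub>j\<close> is zero at \<open>p\<close>, since both \<open>a\<^sub>j q\<^sub>j\<close> and \<open>b\<^sub>j q\<^sub>j\<close> lie in the
  system and one of \<open>a\<^sub>j\<close>, \<open>b\<^sub>j\<close> is nonzero at \<open>p\<close>.

  It remains to see that the genericity conditions define a dense open set of configurations. They are the
  nonvanishing of one polynomial in the entries of the frames. Two frames define the same
  subspace iff they differ by an invertible \<open>2\<close> by \<open>2\<close> matrix, so configurations that have some generic choice of
  frames form an open set. It is dense because the polynomial is nonzero at one explicit point and affine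
  space is irreducible.
\<close>

section \<open>Evaluation of polynomials\<close>

definition monom_eval :: "('v \<Rightarrow> 'b::comm_ring_1) \<Rightarrow> ('v \<Rightarrow>\<^sub>0 nat) \<Rightarrow> 'b" where
  "monom_eval x m = (\<Prod>v\<in>Poly_Mapping.keys m. x v ^ Poly_Mapping.lookup m v)"

definition monom_degree :: "('v \<Rightarrow>\<^sub>0 nat) \<Rightarrow> nat" where
  "monom_degree m = (\<Sum>v\<in>Poly_Mapping.keys m. Poly_Mapping.lookup m v)"

lemma mpol_eval_monom_eval:
  "mpol_eval h x f = (\<Sum>m\<in>Poly_Mapping.keys f. h (Poly_Mapping.lookup f m) * monom_eval x m)"
  by (simp add: mpol_eval_def monom_eval_def)

lemma monom_eval_superset:
  assumes "finite V" "Poly_Mapping.keys m \<subseteq> V"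
  shows "monom_eval x m = (\<Prod>v\<in>V. x v ^ Poly_Mapping.lookup m v)"
  unfolding monom_eval_def using assms
  by (intro prod.mono_neutral_left) (auto simp: in_keys_iff)

lemma monom_eval_add: "monom_eval x (m + m') = monom_eval x m * monom_eval x m'"
proof -
  let ?V = "Poly_Mapping.keys m \<union> Poly_Mapping.keys m'"
  have "monom_eval x k = (\<Prod>v\<in>?V. x v ^ Poly_Mapping.lookup k v)" if "k \<in> {m, m', m + m'}" for k
    using that keys_add[of m m'] by (intro monom_eval_superset) auto
  then show ?thesis
    by (simp add: lookup_add power_add prod.distrib)
qed

lemma monom_eval_0 [simp]: "monom_eval x 0 = 1"
  by (simp add: monom_eval_def)

lemma monom_eval_single [simp]: "monom_eval x (Poly_Mapping.single v k) = x v ^ k"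
  by (simp add: monom_eval_def)

lemma monom_degree_add: "monom_degree (m + m') = monom_degree m + monom_degree m'"
  unfolding monom_degree_def by (rule setsum_keys_plus_distrib) auto

lemma monom_degree_single [simp]: "monom_degree (Poly_Mapping.single v k) = k"
  by (simp add: monom_degree_def)

lemma monom_degree_0 [simp]: "monom_degree 0 = 0"
  by (simp add: monom_degree_def)

lemma mpol_as_sum:
  "f = (\<Sum>m\<in>Poly_Mapping.keys f. Poly_Mapping.single m (Poly_Mapping.lookup f m))"
  by (rule poly_mapping_eqI)
     (auto simp: lookup_sum lookup_single when_def in_keys_iff if_distrib cong: if_cong)

text \<open>Evaluation along a homomorphism is itself a ring homomorphism, so it commutes with the
determinants of matrices of polynomials by which the hypersurfaces are constructed.\<close>
context comm_ring_hom
begin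

lemma mpol_eval_zero [simp]: "mpol_eval hom x 0 = 0"
  by (simp add: mpol_eval_def)

lemma mpol_eval_add: "mpol_eval hom x (f + g) = mpol_eval hom x f + mpol_eval hom x g"
  unfolding mpol_eval_monom_eval
  by (rule setsum_keys_plus_distrib) (auto simp: hom_add algebra_simps)

lemma mpol_eval_sum: "mpol_eval hom x (sum F I) = (\<Sum>i\<in>I. mpol_eval hom x (F i))"
  by (induction I rule: infinite_finite_induct) (auto simp: mpol_eval_add)

lemma mpol_eval_single: "mpol_eval hom x (Poly_Mapping.single m c) = hom c * monom_eval x m"
  by (simp add: mpol_eval_monom_eval)

lemma mpol_eval_const [simp]: "mpol_eval hom x (Poly_Mapping.single 0 c) = hom c"
  by (simp add: mpol_eval_single)

lemma mpol_eval_mult: "mpol_eval hom x (f * g) = mpol_eval hom x f * mpol_eval hom x g"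
proof -
  have "f * g = (\<Sum>m\<in>Poly_Mapping.keys f. Poly_Mapping.single m (Poly_Mapping.lookup f m)) *
      (\<Sum>k\<in>Poly_Mapping.keys g. Poly_Mapping.single k (Poly_Mapping.lookup g k))"
    by (simp flip: mpol_as_sum)
  also have "\<dots> = (\<Sum>m\<in>Poly_Mapping.keys f. \<Sum>k\<in>Poly_Mapping.keys g.
      Poly_Mapping.single (m + k) (Poly_Mapping.lookup f m * Poly_Mapping.lookup g k))"
    by (simp add: sum_product mult_single)
  also have "mpol_eval hom x \<dots> = (\<Sum>m\<in>Poly_Mapping.keys f. \<Sum>k\<in>Poly_Mapping.keys g.
      (hom (Poly_Mapping.lookup f m) * monom_eval x m) *
      (hom (Poly_Mapping.lookup g k) * monom_eval x k))"
    by (simp add: mpol_eval_sum mpol_eval_single monom_eval_add hom_mult mult_ac)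
  also have "\<dots> = mpol_eval hom x f * mpol_eval hom x g"
    by (simp add: mpol_eval_monom_eval sum_product)
  finally show ?thesis .
qed

lemma mpol_eval_hom: "comm_ring_hom (mpol_eval hom x)"
proof
  show "mpol_eval hom x 1 = 1"
    using mpol_eval_const[of x 1] by simp
qed (auto simp: mpol_eval_add mpol_eval_mult)

end

lemma comm_ring_hom_to_ac: "comm_ring_hom (to_ac :: 'k::field \<Rightarrow> _)"
  by unfold_locales auto

lemma comm_ring_hom_id: "comm_ring_hom (id :: 'k::comm_ring_1 \<Rightarrow> 'k)"
  by unfold_locales auto

lemma mpol_eval_cong:
  assumes "f \<in> mpols_in V" "\<And>v. v \<in> V \<Longrightarrow> x v = y v"
  shows "mpol_eval h x f = mpol_eval h y f"
  unfolding mpol_eval_def using assms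
  by (intro sum.cong prod.cong arg_cong2[where f = "(*)"] refl) (auto simp: mpols_in_def subset_iff)

lemma mpols_in_add: "f \<in> mpols_in V \<Longrightarrow> g \<in> mpols_in V \<Longrightarrow> f + g \<in> mpols_in V"
  using keys_add[of f g] by (auto simp: mpols_in_def)

lemma mpols_in_mult: "f \<in> mpols_in V \<Longrightarrow> g \<in> mpols_in V \<Longrightarrow> f * g \<in> mpols_in V"
proof (unfold mpols_in_def, clarify)
  fix m v
  assume f: "\<forall>m\<in>Poly_Mapping.keys f. Poly_Mapping.keys m \<subseteq> V"
    and g: "\<forall>m\<in>Poly_Mapping.keys g. Poly_Mapping.keys m \<subseteq> V"
    and m: "m \<in> Poly_Mapping.keys (f * g)" "v \<in> Poly_Mapping.keys m"
  then obtain a b where "m = a + b" "a \<in> Poly_Mapping.keys f" "b \<in> Poly_Mapping.keys g"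
    using keys_mult[of f g] by blast
  then show "v \<in> V"
    using f g m(2) keys_add[of a b] by blast
qed

lemma mpols_in_single:
  "Poly_Mapping.keys m \<subseteq> V \<Longrightarrow> Poly_Mapping.single m c \<in> mpols_in V"
  by (auto simp: mpols_in_def)

section \<open>Spaces of forms\<close>

lemma forms_iff:
  "f \<in> forms n d \<longleftrightarrow>
     (\<forall>m\<in>Poly_Mapping.keys f. Poly_Mapping.keys m \<subseteq> {..n} \<and> monom_degree m = d)"
  by (auto simp: forms_def mpols_in_def monom_degree_def)

lemma forms_zero [simp]: "0 \<in> forms n d"
  by (simp add: forms_iff)

lemma forms_add: "f \<in> forms n d \<Longrightarrow> g \<in> forms n d \<Longrightarrow> f + g \<in> forms n d"
  using keys_add[of f g] by (auto simp: forms_iff)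

lemma forms_sum: "(\<And>i. i \<in> I \<Longrightarrow> F i \<in> forms n d) \<Longrightarrow> sum F I \<in> forms n d"
  by (induction I rule: infinite_finite_induct) (auto intro: forms_add)

lemma forms_mult:
  assumes "f \<in> forms n d" "g \<in> forms n e"
  shows "f * g \<in> forms n (d + e)"
  unfolding forms_iff
proof
  fix m assume "m \<in> Poly_Mapping.keys (f * g)"
  then obtain a b where "m = a + b" "a \<in> Poly_Mapping.keys f" "b \<in> Poly_Mapping.keys g"
    using keys_mult[of f g] by blast
  then show "Poly_Mapping.keys m \<subseteq> {..n} \<and> monom_degree m = d + e"
    using assms keys_add[of a b] unfolding forms_iff by (metis Un_subset_iff monom_degree_add subset_trans)
qed

lemma forms_const: "Poly_Mapping.single 0 c \<in> forms n 0"
  by (simp add: forms_iff)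

lemma forms_smult: "f \<in> forms n d \<Longrightarrow> Poly_Mapping.single 0 c * f \<in> forms n d"
  using forms_mult[OF forms_const] by fastforce

lemma forms_prod:
  "(\<And>i. i \<in> I \<Longrightarrow> F i \<in> forms n (e i)) \<Longrightarrow> prod F I \<in> forms n (\<Sum>i\<in>I. e i)"
  by (induction I rule: infinite_finite_induct) (use forms_const[of 1 n] in \<open>auto intro: forms_mult\<close>)

definition linear_form :: "nat \<Rightarrow> (nat \<Rightarrow> 'k::comm_ring_1) \<Rightarrow> (nat, 'k) mpol" where
  "linear_form n a = (\<Sum>k\<le>n. Poly_Mapping.single (Poly_Mapping.single k 1) (a k))"

lemma linear_form_in_forms: "linear_form n a \<in> forms n 1"
  unfolding linear_form_def by (intro forms_sum) (auto simp: forms_iff)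

lemma (in comm_ring_hom) mpol_eval_linear_form:
  "mpol_eval hom x (linear_form n a) = (\<Sum>k\<le>n. hom (a k) * x k)"
  by (simp add: linear_form_def mpol_eval_sum mpol_eval_single)

text \<open>The degree is controlled for each permutation and not for each entry: the matrices in question mix
entries of degree zero and one, and only whole terms of the Leibniz expansion have a common
degree.\<close>
lemma forms_det:
  assumes A: "A \<in> carrier_mat N N"
    and "\<And>p. p permutes {0..<N} \<Longrightarrow> (\<Prod>i = 0..<N. A $$ (i, p i)) \<in> forms n d"
  shows "det A \<in> forms n d"
  unfolding det_def'[OF A]
proof (rule forms_sum)
  fix p assume "p \<in> {p. p permutes {0..<N}}"
  then have "Poly_Mapping.single 0 (signof p) * (\<Prod>i = 0..<N. A $$ (i, p i)) \<in> forms n d"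
    using assms(2) by (intro forms_smult) auto
  moreover have "(signof p :: (nat, 'a) mpol) = Poly_Mapping.single 0 (signof p)"
    by (cases "evenperm p") (simp_all add: sign_def single_uminus)
  ultimately show "signof p * (\<Prod>i = 0..<N. A $$ (i, p i)) \<in> forms n d"
    by (simp only:)
qed

section \<open>Homogeneous polynomial functions\<close>

text \<open>The functions given by homogeneous polynomials of degree \<open>d\<close> in the variables \<open>S\<close>, described
without monomials: a form of positive degree is \<open>\<Sum>\<^sub>v x\<^sub>v f\<^sub>v\<close> with \<open>f\<^sub>v\<close> of smaller degree. The \<open>f\<^sub>v\<close> are
not unique, but this does no harm, and it turns each closure property below into an
induction on the degree.\<close>
fun hom_funs :: "'v set \<Rightarrow> nat \<Rightarrow> (('v \<Rightarrow> 'a::field) \<Rightarrow> 'a) set" where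
  "hom_funs S 0 = range (\<lambda>c x. c)"
| "hom_funs S (Suc d) = {\<lambda>x. \<Sum>v\<in>S. x v * f v x | f. \<forall>v\<in>S. f v \<in> hom_funs S d}"

lemma hom_funs_SucI:
  "(\<And>v. v \<in> S \<Longrightarrow> f v \<in> hom_funs S d) \<Longrightarrow> (\<lambda>x. \<Sum>v\<in>S. x v * f v x) \<in> hom_funs S (Suc d)"
  by auto

lemma hom_funs_SucE:
  assumes "F \<in> hom_funs S (Suc d)"
  obtains f where "F = (\<lambda>x. \<Sum>v\<in>S. x v * f v x)" "\<And>v. v \<in> S \<Longrightarrow> f v \<in> hom_funs S d"
  using assms by auto

lemma hom_funs_zero: "(\<lambda>x. 0) \<in> hom_funs S d"
  by (induction d) (use hom_funs_SucI[of S "\<lambda>_ _. 0"] in auto)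

lemma hom_funs_lincomb:
  assumes "F \<in> hom_funs S d" "G \<in> hom_funs S d"
  shows "(\<lambda>x. a * F x + b * G x) \<in> hom_funs S d"
  using assms
proof (induction d arbitrary: F G)
  case 0
  then show ?case by auto
next
  case (Suc d)
  from Suc.prems obtain f g where
    f: "F = (\<lambda>x. \<Sum>v\<in>S. x v * f v x)" "\<And>v. v \<in> S \<Longrightarrow> f v \<in> hom_funs S d" and
    g: "G = (\<lambda>x. \<Sum>v\<in>S. x v * g v x)" "\<And>v. v \<in> S \<Longrightarrow> g v \<in> hom_funs S d"
    by (elim hom_funs_SucE) blast
  have "(\<lambda>x. \<Sum>v\<in>S. x v * (a * f v x + b * g v x)) \<in> hom_funs S (Suc d)"
    using f(2) g(2) by (intro hom_funs_SucI Suc.IH)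
  also have "(\<lambda>x. \<Sum>v\<in>S. x v * (a * f v x + b * g v x)) = (\<lambda>x. a * F x + b * G x)"
    unfolding f g by (auto simp: sum_distrib_left algebra_simps sum.distrib)
  finally show ?case .
qed

lemma hom_funs_add:
  "F \<in> hom_funs S d \<Longrightarrow> G \<in> hom_funs S d \<Longrightarrow> (\<lambda>x. F x + G x) \<in> hom_funs S d"
  using hom_funs_lincomb[of F S d G 1 1] by simp

lemma hom_funs_scale:
  "F \<in> hom_funs S d \<Longrightarrow> (\<lambda>x. a * F x) \<in> hom_funs S d"
  using hom_funs_lincomb[of F S d F a 0] by simp

lemma hom_funs_sum:
  "(\<And>i. i \<in> I \<Longrightarrow> F i \<in> hom_funs S d) \<Longrightarrow> (\<lambda>x. \<Sum>i\<in>I. F i x) \<in> hom_funs S d"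
  by (induction I rule: infinite_finite_induct) (auto intro: hom_funs_zero hom_funs_add)

lemma hom_funs_mult_linear:
  assumes "F \<in> hom_funs S d"
  shows "(\<lambda>x. (\<Sum>v\<in>S. c v * x v) * F x) \<in> hom_funs S (Suc d)"
proof -
  have "(\<lambda>x. \<Sum>v\<in>S. x v * (c v * F x)) \<in> hom_funs S (Suc d)"
    by (intro hom_funs_SucI hom_funs_scale assms)
  also have "(\<lambda>x. \<Sum>v\<in>S. x v * (c v * F x)) = (\<lambda>x. (\<Sum>v\<in>S. c v * x v) * F x)"
    by (simp add: sum_distrib_right mult.assoc mult.left_commute)
  finally show ?thesis .
qed

lemma hom_funs_mult_var:
  assumes "F \<in> hom_funs S d" "v \<in> S" "finite S"
  shows "(\<lambda>x. x v * F x) \<in> hom_funs S (Suc d)"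
proof -
  have "(\<Sum>u\<in>S. (if u = v then 1 else 0) * x u) = x v" for x :: "_ \<Rightarrow> 'b"
    using assms by (simp add: if_distrib[of "\<lambda>t. t * _"] cong: if_cong)
  then show ?thesis
    using hom_funs_mult_linear[OF assms(1), of "\<lambda>u. if u = v then 1 else 0"] by simp
qed

lemma hom_funs_cong:
  assumes "F \<in> hom_funs S d" "\<And>v. v \<in> S \<Longrightarrow> x v = y v"
  shows "F x = F y"
  using assms(1)
proof (induction d arbitrary: F)
  case (Suc d)
  from Suc.prems obtain f where
    f: "F = (\<lambda>x. \<Sum>v\<in>S. x v * f v x)" "\<And>v. v \<in> S \<Longrightarrow> f v \<in> hom_funs S d"
    by (elim hom_funs_SucE) blast
  show ?case
    unfolding f(1) using Suc.IH[OF f(2)] assms(2) by (intro sum.cong) auto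
qed auto

lemma hom_funs_eq_0_at_0:
  assumes "F \<in> hom_funs S (Suc d)" "\<And>v. v \<in> S \<Longrightarrow> x v = 0"
  shows "F x = 0"
  using assms by (auto elim!: hom_funs_SucE)

text \<open>This covers changes of coordinates as well as restrictions to coordinate subspaces.\<close>
lemma hom_funs_linear_subst:
  assumes "F \<in> hom_funs S d"
  shows "(\<lambda>y. F (\<lambda>v. \<Sum>k\<in>S'. T v k * y k)) \<in> hom_funs S' d"
  using assms
proof (induction d arbitrary: F)
  case (Suc d)
  from Suc.prems obtain f where
    f: "F = (\<lambda>x. \<Sum>v\<in>S. x v * f v x)" "\<And>v. v \<in> S \<Longrightarrow> f v \<in> hom_funs S d"
    by (elim hom_funs_SucE) blast
  have "(\<lambda>y. \<Sum>v\<in>S. (\<Sum>k\<in>S'. T v k * y k) * f v (\<lambda>v. \<Sum>k\<in>S'. T v k * y k))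
          \<in> hom_funs S' (Suc d)"
    by (intro hom_funs_sum hom_funs_mult_linear Suc.IH f(2))
  then show ?case
    unfolding f(1) .
qed auto

lemma hom_funs_restrict:
  assumes "F \<in> hom_funs S d" "finite S'"
  shows "(\<lambda>y. F (\<lambda>v. if v \<in> S' then y v else 0)) \<in> hom_funs S' d"
proof -
  have "(\<Sum>k\<in>S'. (if v = k then 1 else 0) * y k) = (if v \<in> S' then y v else 0)" for v and y :: "_ \<Rightarrow> 'b"
    using assms(2) by (simp add: if_distrib[of "\<lambda>t. t * _"] cong: if_cong)
  then show ?thesis
    using hom_funs_linear_subst[OF assms(1), of "\<lambda>v k. if v = k then 1 else 0" S'] by simp
qed

lemma hom_funs_poly_on_line:
  assumes "F \<in> hom_funs S d"
  shows "\<exists>p. \<forall>t. F (\<lambda>v. x v + t * y v) = poly p t"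
  using assms
proof (induction d arbitrary: F)
  case 0
  then obtain c where "F = (\<lambda>x. c)" by auto
  then show ?case by (intro exI[of _ "[:c:]"]) auto
next
  case (Suc d)
  from Suc.prems obtain f where
    f: "F = (\<lambda>x. \<Sum>v\<in>S. x v * f v x)" "\<And>v. v \<in> S \<Longrightarrow> f v \<in> hom_funs S d"
    by (elim hom_funs_SucE) blast
  from Suc.IH[OF f(2)] obtain p where
    p: "\<And>v t. v \<in> S \<Longrightarrow> f v (\<lambda>v. x v + t * y v) = poly (p v) t"
    by metis
  show ?case
    by (rule exI[of _ "\<Sum>v\<in>S. [:x v, y v:] * p v"]) (auto simp: f(1) p poly_sum algebra_simps)
qed

text \<open>A substitute for density of nonempty Zariski-open sets: on a line, a polynomial with infinitely
many zeros vanishes. In the applications \<open>x\<close> lies on a hyperplane where information is missing and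
\<open>y\<close> points out of this hyperplane.\<close>
lemma hom_funs_eq_0_line:
  fixes x y :: "'v \<Rightarrow> 'a::field_char_0"
  assumes "F \<in> hom_funs S d"
    and "\<And>t. t \<noteq> 0 \<Longrightarrow> F (\<lambda>v. x v + t * y v) = 0"
  shows "F x = 0"
proof -
  obtain p where p: "\<And>t. F (\<lambda>v. x v + t * y v) = poly p t"
    using hom_funs_poly_on_line[OF assms(1), of x y] by blast
  have "UNIV - {0} \<subseteq> {t. poly p t = 0}"
    using assms(2) p by auto
  then have "infinite {t. poly p t = 0}"
    using infinite_UNIV_char_0[where 'a = 'a] finite_subset by fastforce
  then have "p = 0"
    using poly_roots_finite by blast
  then show ?thesis
    using p[of 0] by simp
qed

text \<open>Division with remainder by a linear form \<open>b\<close>: the linear projection onto the hyperplane \<open>b = 0\<close>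
along the coordinate \<open>k\<close> moves \<open>x\<close> by a multiple of \<open>b x\<close>, hence changes each form by a
multiple of \<open>b\<close>.\<close>
lemma hom_funs_diff_divisible:
  fixes b :: "'v \<Rightarrow> 'a::field"
  assumes "finite S" "k \<in> S" "b k \<noteq> 0" "F \<in> hom_funs S (Suc d)"
  shows "\<exists>g \<in> hom_funs S d. \<forall>x.
           F x - F (x(k := x k - (\<Sum>v\<in>S. b v * x v) / b k)) = (\<Sum>v\<in>S. b v * x v) * g x"
  using assms(4)
proof (induction d arbitrary: F)
  case 0
  then obtain f where f: "F = (\<lambda>x. \<Sum>v\<in>S. x v * f v x)" "\<And>v. v \<in> S \<Longrightarrow> f v \<in> hom_funs S 0"
    by (elim hom_funs_SucE) blast
  then obtain c where c: "\<And>v x. v \<in> S \<Longrightarrow> f v x = c v"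
    by (auto simp: image_iff) metis
  have "F x - F (x(k := x k - s)) = s * c k" for x s
  proof -
    have "F x - F (x(k := x k - s)) = (\<Sum>v\<in>S. if v = k then s * c v else 0)"
      unfolding f(1) sum_subtractf[symmetric] by (intro sum.cong) (auto simp: c algebra_simps)
    then show ?thesis
      using assms(1,2) by simp
  qed
  then show ?case
    using assms(3) by (intro bexI[of _ "\<lambda>x. c k / b k"]) (auto simp del: fun_upd_apply)
next
  case (Suc d)
  define l where "l x = (\<Sum>v\<in>S. b v * x v)" for x
  define \<sigma> where "\<sigma> x = x(k := x k - l x / b k)" for x
  from Suc.prems obtain f where
    f: "F = (\<lambda>x. \<Sum>v\<in>S. x v * f v x)" "\<And>v. v \<in> S \<Longrightarrow> f v \<in> hom_funs S (Suc d)"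
    by (elim hom_funs_SucE) blast
  from Suc.IH[OF f(2)] obtain g where
    g: "\<And>v. v \<in> S \<Longrightarrow> g v \<in> hom_funs S d"
      "\<And>v x. v \<in> S \<Longrightarrow> f v x - f v (\<sigma> x) = l x * g v x"
    unfolding l_def \<sigma>_def by metis
  have \<sigma>: "\<sigma> x v = (\<Sum>u\<in>S. ((if v = u then 1 else 0) - (if v = k then b u / b k else 0)) * x u)"
    if "v \<in> S" for x v
  proof -
    have "(\<Sum>u\<in>S. ((if v = u then 1 else 0) - (if v = k then b u / b k else 0)) * x u) =
        (\<Sum>u\<in>S. (if u = v then x u else 0) - (if v = k then b u * x u / b k else 0))"
      by (intro sum.cong) (auto simp: left_diff_distrib)
    also have "\<dots> = (\<Sum>u\<in>S. (if u = v then x u else 0)) - (if v = k then l x / b k else 0)"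
      by (simp add: l_def sum_subtractf sum_divide_distrib)
    finally have "(\<Sum>u\<in>S. ((if v = u then 1 else 0) - (if v = k then b u / b k else 0)) * x u) =
        (\<Sum>u\<in>S. (if u = v then x u else 0)) - (if v = k then l x / b k else 0)" .
    then show ?thesis
      using that assms(1) by (simp add: \<sigma>_def)
  qed
  have "(\<lambda>x. f k x / b k) \<in> hom_funs S (Suc d)"
    using hom_funs_scale[OF f(2)[OF assms(2)], of "1 / b k"] by simp
  moreover have "(\<lambda>x. \<Sum>v\<in>S. \<sigma> x v * g v x) \<in> hom_funs S (Suc d)"
  proof -
    have "(\<lambda>x. \<Sum>v\<in>S. (\<Sum>u\<in>S. ((if v = u then 1 else 0) - (if v = k then b u / b k else 0)) * x u) * g v x)
      \<in> hom_funs S (Suc d)"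
      by (intro hom_funs_sum hom_funs_mult_linear g(1))
    then show ?thesis
      by (simp add: \<sigma>)
  qed
  ultimately have "(\<lambda>x. f k x / b k + (\<Sum>v\<in>S. \<sigma> x v * g v x)) \<in> hom_funs S (Suc d)"
    by (rule hom_funs_add)
  moreover have "F x - F (\<sigma> x) = l x * (f k x / b k + (\<Sum>v\<in>S. \<sigma> x v * g v x))" for x
  proof -
    have "F x - F (\<sigma> x) = (\<Sum>v\<in>S. (x v - \<sigma> x v) * f v x + \<sigma> x v * (f v x - f v (\<sigma> x)))"
      unfolding f(1) sum_subtractf[symmetric] by (intro sum.cong) (auto simp: algebra_simps)
    also have "\<dots> = (\<Sum>v\<in>S. (if v = k then l x / b k * f v x else 0)) + (\<Sum>v\<in>S. \<sigma> x v * (l x * g v x))"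
      unfolding sum.distrib[symmetric]
    proof (intro sum.cong refl)
      fix v assume "v \<in> S"
      moreover have "x v - \<sigma> x v = (if v = k then l x / b k else 0)"
        by (simp add: \<sigma>_def)
      ultimately show "(x v - \<sigma> x v) * f v x + \<sigma> x v * (f v x - f v (\<sigma> x)) =
          (if v = k then l x / b k * f v x else 0) + \<sigma> x v * (l x * g v x)"
        by (simp add: g(2))
    qed
    also have "\<dots> = l x * (f k x / b k + (\<Sum>v\<in>S. \<sigma> x v * g v x))"
      using assms(1,2) by (simp add: sum_distrib_left algebra_simps)
    finally show ?thesis .
  qed
  ultimately have "\<exists>g\<in>hom_funs S (Suc d). \<forall>x. F x - F (\<sigma> x) = l x * g x"
    by (intro bexI[of _ "\<lambda>x. f k x / b k + (\<Sum>v\<in>S. \<sigma> x v * g v x)"] allI)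
  then show ?case
    by (simp only: \<sigma>_def l_def)
qed

lemma hom_funs_linear_factor:
  fixes b :: "'v \<Rightarrow> 'a::field"
  assumes "finite S" "k \<in> S" "b k \<noteq> 0" "F \<in> hom_funs S (Suc d)"
    and "\<And>x. (\<Sum>v\<in>S. b v * x v) = 0 \<Longrightarrow> F x = 0"
  obtains g where "g \<in> hom_funs S d" "\<And>x. F x = (\<Sum>v\<in>S. b v * x v) * g x"
proof -
  obtain g where g: "g \<in> hom_funs S d"
    "\<And>x. F x - F (x(k := x k - (\<Sum>v\<in>S. b v * x v) / b k)) = (\<Sum>v\<in>S. b v * x v) * g x"
    using hom_funs_diff_divisible[of S k b F d, OF assms(1-4)] by blast
  have "F (x(k := x k - (\<Sum>v\<in>S. b v * x v) / b k)) = 0" for x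
  proof (rule assms(5))
    let ?s = "(\<Sum>v\<in>S. b v * x v) / b k"
    have "(\<Sum>v\<in>S. b v * (x(k := x k - ?s)) v) = (\<Sum>v\<in>S. b v * x v - (if v = k then b v * ?s else 0))"
      by (intro sum.cong) (auto simp: algebra_simps)
    also have "\<dots> = 0"
      using assms(1-3) by (simp add: sum_subtractf)
    finally show "(\<Sum>v\<in>S. b v * (x(k := x k - ?s)) v) = 0" .
  qed
  with g show ?thesis
    by (intro that[of g]) auto
qed

text \<open>A form that vanishes on more coordinate hyperplanes than its degree is zero, since it is divisible
by the product of the corresponding variables. The variables are split off one at a time; the
cofactor inherits the vanishing on the other hyperplanes at points off the hyperplane already
treated, and thence everywhere.\<close>
lemma hom_funs_eq_0_of_hyperplanes:
  fixes F :: "('v \<Rightarrow> 'a::field_char_0) \<Rightarrow> 'a"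
  assumes "finite S" "T \<subseteq> S" "F \<in> hom_funs S d" "d < card T"
    and "\<And>i x. i \<in> T \<Longrightarrow> x i = 0 \<Longrightarrow> F x = 0"
  shows "F x = 0"
  using assms(2-)
proof (induction d arbitrary: F T x)
  case 0
  then obtain i where i: "i \<in> T" by fastforce
  have "F x = F (\<lambda>_. 0)"
    using 0(2) by auto
  then show ?case
    using 0(4)[OF i] by simp
next
  case (Suc d)
  have "finite T"
    using Suc.prems(1) assms(1) finite_subset by blast
  from Suc.prems(3) obtain i where i: "i \<in> T" by fastforce
  have S: "i \<in> S" using i Suc.prems(1) by auto
  have ind: "(\<Sum>v\<in>S. (if v = i then 1 else 0) * x v) = x i" for x :: "'v \<Rightarrow> 'a"
    using S assms(1) by (simp add: if_distrib[of "\<lambda>t. t * _"] cong: if_cong)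
  obtain g where g: "g \<in> hom_funs S d" "\<And>x. F x = x i * g x"
  proof (rule hom_funs_linear_factor[of S i "\<lambda>v. if v = i then 1 else 0" F d])
    show "F x = 0" if "(\<Sum>v\<in>S. (if v = i then 1 else 0) * x v) = 0" for x
      using Suc.prems(4)[OF i] that unfolding ind by auto
  qed (use assms(1) S Suc.prems(2) in \<open>auto simp: ind\<close>)
  have "g x = 0" for x
  proof (rule Suc.IH[OF _ g(1)])
    show "T - {i} \<subseteq> S" "d < card (T - {i})"
      using Suc.prems(1,3) i \<open>finite T\<close> by auto
    show "g x = 0" if j: "j \<in> T - {i}" "x j = 0" for j and x :: "'v \<Rightarrow> 'a"
    proof -
      have nz: "g z = 0" if "z j = 0" "z i \<noteq> 0" for z
        using Suc.prems(4)[of j z] g(2)[of z] j that by auto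
      show "g x = 0"
      proof (cases "x i = 0")
        case True
        show ?thesis
          by (rule hom_funs_eq_0_line[OF g(1), of _ "\<lambda>v. if v = i then 1 else 0"])
             (rule nz, use j True in auto)
      qed (use nz j in auto)
    qed
  qed
  then show ?case
    using g(2) by simp
qed

section \<open>Forms vanishing on generic codimension two subspaces\<close>

abbreviation unit_point :: "'v \<Rightarrow> 'v \<Rightarrow> 'a::zero_neq_one" where
  "unit_point i \<equiv> (\<lambda>v. if v = i then 1 else 0)"

text \<open>Row \<open>i\<close> holds the coefficients of a linear form \<open>b\<^sub>i\<close> that cuts out a codimension two subspace
together with the \<open>i\<close>-th coordinate and so matters only modulo this coordinate. The inequalities say that
\<open>b\<^sub>i\<close> is nonzero at the other vertices of the coordinate simplex and that \<open>b\<^sub>i\<close>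
and \<open>b\<^sub>j\<close> stay independent on each coordinate line missing the vertices \<open>i\<close> and \<open>j\<close>.\<close>
definition generic_matrix :: "nat \<Rightarrow> (nat \<Rightarrow> nat \<Rightarrow> 'a::field) \<Rightarrow> bool" where
  "generic_matrix n B \<longleftrightarrow>
     (\<forall>i\<le>n. \<forall>k\<le>n. i \<noteq> k \<longrightarrow> B i k \<noteq> 0) \<and>
     (\<forall>i\<le>n. \<forall>j\<le>n. \<forall>k\<le>n. \<forall>l\<le>n. distinct [i, j, k, l] \<longrightarrow> B i k * B j l - B i l * B j k \<noteq> 0)"

lemma generic_matrix_entry: "generic_matrix n B \<Longrightarrow> i \<le> n \<Longrightarrow> k \<le> n \<Longrightarrow> i \<noteq> k \<Longrightarrow> B i k \<noteq> 0"
  by (simp add: generic_matrix_def)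

lemma generic_matrix_minor:
  "generic_matrix n B \<Longrightarrow> i \<le> n \<Longrightarrow> j \<le> n \<Longrightarrow> k \<le> n \<Longrightarrow> l \<le> n \<Longrightarrow> distinct [i, j, k, l] \<Longrightarrow>
     B i k * B j l - B i l * B j k \<noteq> 0"
  by (simp add: generic_matrix_def)

text \<open>The heart of the proof. Restrict \<open>F\<close> to the hyperplane \<open>x\<^sub>i = 0\<close>. There it vanishes on \<open>b\<^sub>i = 0\<close>, so it
is \<open>b\<^sub>i\<close> times a form \<open>g\<close> of smaller degree in one variable less. Since \<open>b\<^sub>i\<close> is nonzero at the
vertices and is not identically zero on the traces of the other subspaces, \<open>g\<close> satisfies the same
hypotheses and is zero by induction. Thus \<open>F\<close> vanishes on all coordinate hyperplanes, of which there
are more than its degree.\<close>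
lemma hom_funs_eq_0_of_generic:
  fixes B :: "nat \<Rightarrow> nat \<Rightarrow> 'a::field_char_0"
  assumes B: "generic_matrix n B"
    and "S \<subseteq> {..n}" "card S = Suc d" "F \<in> hom_funs S d"
    and "\<And>i. i \<in> S \<Longrightarrow> F (unit_point i) = 0"
    and "\<And>i y. i \<in> S \<Longrightarrow> y i = 0 \<Longrightarrow> (\<Sum>k\<in>S - {i}. B i k * y k) = 0 \<Longrightarrow> F y = 0"
  shows "F x = 0"
  using assms(2-)
proof (induction d arbitrary: S F x)
  case 0
  then obtain i where "S = {i}" by (auto simp: card_Suc_eq)
  with 0(3,4) show ?case by auto
next
  case (Suc d)
  have fin: "finite S" using Suc.prems(1) finite_subset by blast
  show ?case
  proof (rule hom_funs_eq_0_of_hyperplanes[OF fin subset_refl Suc.prems(3)])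
    fix i and x :: "nat \<Rightarrow> 'a" assume i: "i \<in> S" and xi: "x i = 0"
    define S' where "S' = S - {i}"
    have S': "S' \<subseteq> {..n}" "card S' = Suc d" "finite S'"
      using Suc.prems(1,2) fin i by (auto simp: S'_def)
    define G where "G y = F (\<lambda>v. if v \<in> S' then y v else 0)" for y
    define b where "b y = (\<Sum>v\<in>S'. B i v * y v)" for y
    have "S' \<noteq> {}" using S'(2) by auto
    then obtain k where k: "k \<in> S'" by blast
    have Bnz: "B i v \<noteq> 0" if "v \<in> S'" for v
      using that S' i Suc.prems(1) by (intro generic_matrix_entry[OF B]) (auto simp: S'_def)
    have G: "G \<in> hom_funs S' (Suc d)"
      unfolding G_def by (rule hom_funs_restrict[OF Suc.prems(3) S'(3)])
    have G0: "G y = 0" if "b y = 0" for y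
      unfolding G_def
    proof (rule Suc.prems(5)[OF i])
      show "(if i \<in> S' then y i else 0) = 0"
        by (simp add: S'_def)
      have "(\<Sum>k\<in>S - {i}. B i k * (if k \<in> S' then y k else 0)) = b y"
        unfolding b_def S'_def by (intro sum.cong) auto
      then show "(\<Sum>k\<in>S - {i}. B i k * (if k \<in> S' then y k else 0)) = 0"
        using that by simp
    qed
    then obtain g where g: "g \<in> hom_funs S' d" "\<And>y. G y = b y * g y"
      using hom_funs_linear_factor[of S' k "B i" G d, OF S'(3) k Bnz[OF k] G] G0
      unfolding b_def by blast
    have b_unit: "b (unit_point j) = B i j" if "j \<in> S'" for j
      using that S'(3) by (simp add: b_def if_distrib[of "\<lambda>t. _ * t"] cong: if_cong)
    have "g y = 0" for y
    proof (rule Suc.IH[OF S'(1,2) g(1)])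
      show g_unit: "g (unit_point j) = 0" if "j \<in> S'" for j
      proof -
        have "(\<lambda>v. if v \<in> S' then unit_point j v else 0) = (unit_point j :: nat \<Rightarrow> 'a)"
          using that by auto
        then have "G (unit_point j) = F (unit_point j)"
          by (simp add: G_def)
        also have "\<dots> = 0" using that Suc.prems(4) by (auto simp: S'_def)
        finally show ?thesis using g(2) b_unit Bnz that by simp
      qed
      fix j y assume j: "j \<in> S'" and yj: "y j = 0" and bj: "(\<Sum>k\<in>S' - {j}. B j k * y k) = 0"
      have nz: "g z = 0" if "z j = 0" "(\<Sum>k\<in>S' - {j}. B j k * z k) = 0" "b z \<noteq> 0" for z
      proof -
        have "(\<Sum>k\<in>S - {j}. B j k * (if k \<in> S' then z k else 0)) = (\<Sum>k\<in>S' - {j}. B j k * z k)"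
          using fin by (intro sum.mono_neutral_cong_right) (auto simp: S'_def)
        then have "G z = 0"
          unfolding G_def using that j by (intro Suc.prems(5)[of j]) (auto simp: S'_def)
        then show ?thesis using g(2) that by simp
      qed
      show "g y = 0"
      proof (cases d)
        case 0
        then have "g y = g (unit_point j)" using g(1) by auto
        then show ?thesis using g_unit j by simp
      next
        case (Suc d')
        then have d: "card (S' - {j}) = Suc d'" using S'(2,3) j by simp
        then have "S' - {j} \<noteq> {}" by (metis card.empty nat.distinct(1))
        then obtain k where kk: "k \<in> S' - {j}" by blast
        have Bj: "B j k \<noteq> 0"
          using kk j S' by (intro generic_matrix_entry[OF B]) auto
        show ?thesis
        proof (cases "S' - {j} = {k}")
          case True
          \<comment> \<open>With only two variables left, the \<open>j\<close>-th subspace is the origin.\<close>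
          then have "y k = 0" using bj Bj by simp
          then have "y v = 0" if "v \<in> S'" for v
            using True yj that by (metis DiffI singletonD)
          then show ?thesis
            using hom_funs_eq_0_at_0[OF g(1)[unfolded Suc]] by blast
        next
          case False
          then obtain l where l: "l \<in> S' - {j}" "l \<noteq> k" using kk by blast
          \<comment> \<open>A point of the \<open>j\<close>-th subspace off the hyperplane \<open>b = 0\<close>; this is where the minors of \<open>B\<close> enter.\<close>
          define z where "z v = (if v = k then B j l else if v = l then - B j k else 0)" for v
          have sum_z: "(\<Sum>v\<in>T. w v * z v) = w k * B j l - w l * B j k"
            if "finite T" "k \<in> T" "l \<in> T" for T w
          proof -
            have "(\<Sum>v\<in>T. w v * z v) =
                (\<Sum>v\<in>T. (if v = k then w v * B j l else 0) - (if v = l then w v * B j k else 0))"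
              using l(2) by (intro sum.cong) (auto simp: z_def)
            then show ?thesis using that by (simp add: sum_subtractf)
          qed
          have "b z = B i k * B j l - B i l * B j k"
            using kk l S'(3) unfolding b_def by (intro sum_z) auto
          also have "\<dots> \<noteq> 0"
            using kk l j i S' Suc.prems(1)
            by (intro generic_matrix_minor[OF B]) (auto simp: S'_def)
          finally have bz: "b z \<noteq> 0" .
          show ?thesis
          proof (cases "b y = 0")
            case True
            show ?thesis
            proof (rule hom_funs_eq_0_line[OF g(1), of y z])
              fix t :: 'a assume "t \<noteq> 0"
              have "(\<Sum>k\<in>S' - {j}. B j k * (y k + t * z k)) =
                  (\<Sum>k\<in>S' - {j}. B j k * y k) + t * (\<Sum>k\<in>S' - {j}. B j k * z k)"
                by (simp add: sum_distrib_left sum.distrib algebra_simps)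
              also have "(\<Sum>k\<in>S' - {j}. B j k * z k) = 0"
                using sum_z[of "S' - {j}" "B j"] kk l S'(3) by simp
              finally have 1: "(\<Sum>k\<in>S' - {j}. B j k * (y k + t * z k)) = 0"
                using bj by simp
              have "b (\<lambda>v. y v + t * z v) = b y + t * b z"
                by (simp add: b_def sum_distrib_left sum.distrib algebra_simps)
              then have 2: "b (\<lambda>v. y v + t * z v) \<noteq> 0"
                using True bz \<open>t \<noteq> 0\<close> by simp
              show "g (\<lambda>v. y v + t * z v) = 0"
                using kk l yj by (intro nz 1 2) (auto simp: z_def)
            qed
          qed (use nz yj bj in auto)
        qed
      qed
    qed
    then have "G x = 0" using g(2) by simp
    moreover have "G x = F x"
      unfolding G_def using xi by (intro hom_funs_cong[OF Suc.prems(3)]) (auto simp: S'_def)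
    ultimately show "F x = 0" by simp
  qed (use Suc.prems(2) in auto)
qed

section \<open>Determinantal equations of the hypersurfaces\<close>

text \<open>Consider the weighted Laplacian of the complete directed graph on \<open>{0, \<dots>, n}\<close> in which the edge from
\<open>i\<close> to \<open>k\<close> has weight \<open>B\<^sub>i\<^sub>k y\<^sub>k\<close>. By the matrix-tree theorem its minor at the
vertex \<open>j\<close> is a sum over spanning trees rooted at \<open>j\<close>, so it is divisible by \<open>y\<^sub>j\<close>; the quotient is
the equation of \<open>Q\<^sub>j\<close>. To have the quotient, up to sign, as a determinant, column \<open>j\<close> is divided by \<open>y\<^sub>j\<close>,
and row \<open>j\<close> is replaced by a unit vector with its entry outside of column \<open>j\<close>. Entries may be numbers
or polynomials.\<close>
definition tree_matrix :: "nat \<Rightarrow> nat \<Rightarrow> (nat \<Rightarrow> nat \<Rightarrow> 'r::comm_ring_1) \<Rightarrow> (nat \<Rightarrow> 'r) \<Rightarrow> 'r mat" where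
  "tree_matrix n j B y = mat (Suc n) (Suc n) (\<lambda>(i, k).
     if i = j then (if k = (if j = 0 then 1 else 0) then 1 else 0)
     else if k = j then B i j
     else if k = i then - (\<Sum>l\<in>{..n} - {i}. B i l * y l)
     else B i k * y k)"

lemma tree_matrix_carrier [simp]: "tree_matrix n j B y \<in> carrier_mat (Suc n) (Suc n)"
  by (simp add: tree_matrix_def)

lemma (in comm_ring_hom) hom_det_tree_matrix:
  "hom (det (tree_matrix n j B y)) = det (tree_matrix n j (\<lambda>i k. hom (B i k)) (\<lambda>k. hom (y k)))"
proof -
  have "map_mat hom (tree_matrix n j B y) = tree_matrix n j (\<lambda>i k. hom (B i k)) (\<lambda>k. hom (y k))"
    by (rule eq_matI) (auto simp: tree_matrix_def hom_distribs)
  then show ?thesis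
    by (metis hom_det)
qed

text \<open>In this form the kernel of the matrix can be read off: the Laplacian kills constant vectors, so here
the vector with entry \<open>y\<^sub>j\<close> at \<open>j\<close> and \<open>1\<close> elsewhere annihilates all rows but the \<open>j\<close>-th.\<close>
lemma tree_matrix_row:
  assumes "i \<le> n" "i \<noteq> j" "j \<le> n"
  shows "(tree_matrix n j B y *\<^sub>v vec (Suc n) v) $ i =
     (\<Sum>k\<in>{..n} - {i}. B i k * ((if k = j then v j else y k * v k) - y k * v i))"
proof -
  let ?N = "tree_matrix n j B y"
  have "(?N *\<^sub>v vec (Suc n) v) $ i = (\<Sum>k\<in>{..n}. ?N $$ (i, k) * v k)"
    using assms by (auto simp: tree_matrix_def scalar_prod_def lessThan_Suc_atMost[symmetric] lessThan_atLeast0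
        intro!: sum.cong)
  also have "\<dots> = ?N $$ (i, i) * v i + (\<Sum>k\<in>{..n} - {i}. ?N $$ (i, k) * v k)"
    using assms by (intro sum.remove) auto
  also have "?N $$ (i, i) * v i = - (\<Sum>k\<in>{..n} - {i}. B i k * y k * v i)"
    using assms by (simp add: tree_matrix_def sum_distrib_right)
  also have "(\<Sum>k\<in>{..n} - {i}. ?N $$ (i, k) * v k) =
      (\<Sum>k\<in>{..n} - {i}. B i k * (if k = j then v j else y k * v k))"
    using assms by (intro sum.cong) (auto simp: tree_matrix_def mult_ac)
  finally show ?thesis
    by (simp add: sum_subtractf right_diff_distrib mult_ac)
qed

lemma tree_matrix_row_special:
  assumes "j \<le> n" "n \<ge> 1"
  shows "(tree_matrix n j B y *\<^sub>v vec (Suc n) v) $ j = v (if j = 0 then 1 else 0)"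
  using assms
  by (auto simp: tree_matrix_def scalar_prod_def if_distrib[of "\<lambda>t. t * _"] cong: if_cong)

text \<open>On the \<open>i\<close>-th subspace column \<open>i\<close> of the Laplacian vanishes, so that the unit vector at \<open>i\<close> lies in
the kernel. The modified row \<open>j\<close> spoils this only if its entry \<open>1\<close> is in column \<open>i\<close>; then the kernel
vector of the Laplacian, with its \<open>i\<close>-th entry deleted, does the job.\<close>
lemma det_tree_matrix_eq_0:
  fixes B :: "nat \<Rightarrow> nat \<Rightarrow> 'a::field"
  assumes "i \<le> n" "j \<le> n" "i \<noteq> j" "n \<ge> 2"
    and yi: "y i = 0" and bi: "(\<Sum>k\<in>{..n} - {i}. B i k * y k) = 0"
  shows "det (tree_matrix n j B y) = 0"
proof -
  let ?N = "tree_matrix n j B y"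
  define k0 :: nat where "k0 = (if j = 0 then 1 else 0)"
  define v where "v k = (if i = k0 then (if k = i then 0 else if k = j then y j else 1)
                         else if k = i then 1 else 0)" for k
  have "?N *\<^sub>v vec (Suc n) v = 0\<^sub>v (Suc n)"
  proof (rule eq_vecI)
    fix r assume "r < dim_vec (0\<^sub>v (Suc n) :: 'a vec)"
    then have r: "r \<le> n" by simp
    have "(?N *\<^sub>v vec (Suc n) v) $ r = 0"
    proof (cases "r = j")
      case True
      then show ?thesis
        using assms by (simp only: tree_matrix_row_special) (auto simp: v_def k0_def)
    next
      case False
      have "(\<Sum>k\<in>{..n} - {r}. B r k * ((if k = j then v j else y k * v k) - y k * v r)) = 0"
      proof (cases "r = i")
        case True
        have "(\<Sum>k\<in>{..n} - {i}. B i k * ((if k = j then v j else y k * v k) - y k * v i)) =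
            (\<Sum>k\<in>{..n} - {i}. (if i = k0 then 1 else - 1) * (B i k * y k))"
          using assms(3) by (intro sum.cong) (auto simp: v_def)
        also have "\<dots> = 0"
          unfolding sum_distrib_left[symmetric] bi by simp
        finally show ?thesis using True by simp
      next
        case False
        then show ?thesis
          using yi assms(3) \<open>r \<noteq> j\<close> by (intro sum.neutral) (auto simp: v_def)
      qed
      then show ?thesis
        using False r assms by (simp add: tree_matrix_row)
    qed
    then show "(?N *\<^sub>v vec (Suc n) v) $ r = 0\<^sub>v (Suc n) $ r"
      using r by simp
  qed (simp add: tree_matrix_def)
  moreover have "vec (Suc n) v \<noteq> 0\<^sub>v (Suc n)"
  proof -
    have "\<exists>k\<le>n. k \<noteq> i \<and> k \<noteq> j"
      using assms(4) by (metis le_trans nat_le_linear numeral_2_eq_2 not_less_eq_eq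
          zero_neq_one One_nat_def le0 n_not_Suc_n)
    then obtain k where k: "k \<le> n" "k \<noteq> i" "k \<noteq> j" by blast
    have "v (if i = k0 then k else i) \<noteq> 0"
      using k by (auto simp: v_def)
    moreover have "(if i = k0 then k else i) < Suc n"
      using k assms(1) by auto
    ultimately show ?thesis
      by (metis index_vec index_zero_vec(1))
  qed
  ultimately show ?thesis
    using det_0_iff_vec_prod_zero_field[OF tree_matrix_carrier] by (meson vec_carrier)
qed

text \<open>At the \<open>j\<close>-th vertex only edges into \<open>j\<close> have nonzero weight, so a kernel vector is constant; and
row \<open>j\<close> makes one of its entries vanish.\<close>
lemma det_tree_matrix_unit_point:
  fixes B :: "nat \<Rightarrow> nat \<Rightarrow> 'a::field"
  assumes "j \<le> n" "n \<ge> 1" and B: "\<And>i. i \<le> n \<Longrightarrow> i \<noteq> j \<Longrightarrow> B i j \<noteq> 0"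
  shows "det (tree_matrix n j B (unit_point j)) \<noteq> 0"
proof
  let ?N = "tree_matrix n j B (unit_point j)"
  define k0 :: nat where "k0 = (if j = 0 then 1 else 0)"
  assume "det ?N = 0"
  then obtain w where w: "w \<in> carrier_vec (Suc n)" "w \<noteq> 0\<^sub>v (Suc n)" "?N *\<^sub>v w = 0\<^sub>v (Suc n)"
    using det_0_iff_vec_prod_zero_field[OF tree_matrix_carrier] by blast
  define v where "v k = w $ k" for k
  have wv: "w = vec (Suc n) v"
    using w(1) by (intro eq_vecI) (auto simp: v_def)
  have 0: "(?N *\<^sub>v vec (Suc n) v) $ i = 0" if "i \<le> n" for i
    using w(3) that by (simp add: wv)
  have "v k0 = 0"
    using 0[OF assms(1)] assms(1,2) by (simp only: tree_matrix_row_special k0_def)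
  have eq: "v i = v j" if i: "i \<le> n" "i \<noteq> j" for i
  proof -
    have "0 = (\<Sum>k\<in>{..n} - {i}. B i k *
        ((if k = j then v j else unit_point j k * v k) - unit_point j k * v i))"
      using 0[OF i(1)] tree_matrix_row[OF i assms(1), of B "unit_point j" v] by simp
    also have "\<dots> = (\<Sum>k\<in>{..n} - {i}. if k = j then B i j * (v j - v i) else 0)"
      by (intro sum.cong) auto
    also have "\<dots> = B i j * (v j - v i)"
      using i assms(1) by simp
    finally show ?thesis
      using B[OF i] by simp
  qed
  have "k0 \<le> n" "k0 \<noteq> j"
    using assms(2) by (auto simp: k0_def)
  then have "v j = 0"
    using eq \<open>v k0 = 0\<close> by metis
  then have "v i = 0" if "i \<le> n" for i
    using eq that by metis
  then have "w = 0\<^sub>v (Suc n)"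
    unfolding wv by (intro eq_vecI) auto
  with w(2) show False by simp
qed

text \<open>A nonzero term of the Leibniz expansion takes one constant from row \<open>j\<close>, another from column \<open>j\<close>, and
linear entries from the remaining \<open>n - 1\<close> rows.\<close>
lemma det_tree_matrix_in_forms:
  fixes B :: "nat \<Rightarrow> nat \<Rightarrow> 'k::field"
  assumes "j \<le> n" "n \<ge> 1" and y: "\<And>k. y k \<in> forms n 1"
  shows "det (tree_matrix n j (\<lambda>i k. Poly_Mapping.single 0 (B i k)) y) \<in> forms n (n - 1)"
proof (rule forms_det[OF tree_matrix_carrier])
  let ?N = "tree_matrix n j (\<lambda>i k. Poly_Mapping.single 0 (B i k)) y"
  fix p assume p: "p permutes {0..<Suc n}"
  show "(\<Prod>i = 0..<Suc n. ?N $$ (i, p i)) \<in> forms n (n - 1)"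
  proof (cases "p j = j")
    case True
    then have "?N $$ (j, p j) = 0"
      using assms(1) by (simp add: tree_matrix_def)
    then have "(\<Prod>i = 0..<Suc n. ?N $$ (i, p i)) = 0"
      using assms(1) by (intro prod_zero) (auto intro!: bexI[of _ j])
    then show ?thesis by (simp only: forms_zero)
  next
    case False
    define e :: "nat \<Rightarrow> nat" where "e i = (if i = j \<or> p i = j then 0 else 1)" for i
    have const: "1 \<in> forms n 0"
      using forms_const[of 1 n] by simp
    have "?N $$ (i, p i) \<in> forms n (e i)" if i: "i \<in> {0..<Suc n}" for i
    proof -
      have "p i < Suc n"
        using p i by (metis atLeastLessThan_iff permutes_in_image)
      moreover have "- (\<Sum>l\<in>{..n} - {i}. Poly_Mapping.single 0 (B i l) * y l) =
          Poly_Mapping.single 0 (- 1) * (\<Sum>l\<in>{..n} - {i}. Poly_Mapping.single 0 (B i l) * y l)"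
        by (simp add: single_uminus)
      ultimately show ?thesis
        using i by (auto simp: tree_matrix_def e_def const intro!: forms_smult forms_sum y[unfolded One_nat_def] forms_const
            simp del: sum_distrib_left)
    qed
    then have "(\<Prod>i = 0..<Suc n. ?N $$ (i, p i)) \<in> forms n (\<Sum>i = 0..<Suc n. e i)"
      by (rule forms_prod)
    also have "(\<Sum>i = 0..<Suc n. e i) = n - 1"
    proof -
      obtain q where q: "p q = j" "q < Suc n"
        using p assms(1) by (metis atLeastLessThan_iff le0 less_Suc_eq_le permutes_def permutes_in_image)
      have inj: "p i = j \<longleftrightarrow> i = q" for i
        using q(1) permutes_inj[OF p] by (auto dest: injD)
      have "q \<noteq> j" using False q(1) by auto
      have "(\<Sum>i = 0..<Suc n. e i) = (\<Sum>i\<in>{0..<Suc n} - {j, q}. 1)"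
        unfolding e_def inj by (intro sum.mono_neutral_cong_right) auto
      also have "\<dots> = n - 1"
        using q(2) assms(1) \<open>q \<noteq> j\<close> by (simp add: card_Diff_subset)
      finally show ?thesis .
    qed
    finally show ?thesis .
  qed
qed

section \<open>Forms and the functions they define\<close>

lemma monom_eval_hom_funs:
  assumes "Poly_Mapping.keys m \<subseteq> {..n}" "monom_degree m = d"
  shows "(\<lambda>x :: nat \<Rightarrow> 'a::field. monom_eval x m) \<in> hom_funs {..n} d"
  using assms
proof (induction d arbitrary: m)
  case 0
  then have "\<forall>v\<in>Poly_Mapping.keys m. Poly_Mapping.lookup m v = 0"
    by (simp add: monom_degree_def)
  then have "Poly_Mapping.keys m = {}"
    by (meson equals0I lookup_eq_zero_in_keys_contradict)
  then show ?case
    by (simp add: monom_eval_def)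
next
  case (Suc d)
  then have "Poly_Mapping.keys m \<noteq> {}"
    by (auto simp: monom_degree_def)
  then obtain v where v: "v \<in> Poly_Mapping.keys m" by blast
  define m' where "m' = m - Poly_Mapping.single v 1"
  have m: "m = Poly_Mapping.single v 1 + m'"
    using v by (intro poly_mapping_eqI)
      (auto simp: m'_def lookup_add lookup_minus lookup_single when_def in_keys_iff)
  have "Poly_Mapping.keys m' \<subseteq> Poly_Mapping.keys m"
    by (auto simp: m'_def in_keys_iff lookup_minus)
  then have "(\<lambda>x :: nat \<Rightarrow> 'a. monom_eval x m') \<in> hom_funs {..n} d"
    using Suc.prems arg_cong[OF m, of monom_degree]
    by (intro Suc.IH) (auto simp: monom_degree_add)
  then have "(\<lambda>x :: nat \<Rightarrow> 'a. x v * monom_eval x m') \<in> hom_funs {..n} (Suc d)"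
    using v Suc.prems(1) by (intro hom_funs_mult_var) auto
  then show ?case
    by (subst m) (simp add: monom_eval_add)
qed

lemma mpol_eval_hom_funs:
  assumes "f \<in> forms n d"
  shows "(\<lambda>x. mpol_eval h x f) \<in> hom_funs {..n} d"
  unfolding mpol_eval_monom_eval using assms
  by (intro hom_funs_sum hom_funs_scale monom_eval_hom_funs) (auto simp: forms_iff)

lemma digits_unique:
  fixes a b :: "nat \<Rightarrow> nat"
  assumes "\<And>v. v \<le> n \<Longrightarrow> a v < N" "\<And>v. v \<le> n \<Longrightarrow> b v < N"
    and "(\<Sum>v\<le>n. a v * N ^ v) = (\<Sum>v\<le>n. b v * N ^ v)" and "v \<le> n"
  shows "a v = b v"
  using assms
proof (induction n arbitrary: a b v)
  case (Suc n)
  have shift: "(\<Sum>v\<le>Suc n. c v * N ^ v) = c 0 + N * (\<Sum>v\<le>n. c (Suc v) * N ^ v)" for c :: "nat \<Rightarrow> nat"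
    by (simp add: sum.atMost_Suc_shift sum_distrib_left mult_ac del: sum.atMost_Suc)
  have 0: "a 0 = b 0"
    using arg_cong[OF Suc.prems(3), of "\<lambda>s. s mod N"] Suc.prems(1,2)[of 0] unfolding shift by simp
  have "N > 0" using Suc.prems(1)[of 0] by simp
  then have "(\<Sum>v\<le>n. a (Suc v) * N ^ v) = (\<Sum>v\<le>n. b (Suc v) * N ^ v)"
    using Suc.prems(3) 0 unfolding shift by simp
  then have "a (Suc u) = b (Suc u)" if "u \<le> n" for u
    using Suc.IH[of "\<lambda>v. a (Suc v)" "\<lambda>v. b (Suc v)" u] Suc.prems(1,2) that by simp
  then show ?case
    using 0 Suc.prems(4) by (cases v) auto
qed simp

text \<open>Kronecker substitution: setting \<open>x\<^sub>v = t ^ (N ^ v)\<close> with \<open>N\<close> larger than all exponents sends distinct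
monomials to distinct powers of \<open>t\<close>, because an exponent vector is determined by its digits in base
\<open>N\<close>.\<close>
lemma mpol_eq_0_if_eval_0:
  fixes f :: "(nat, 'a::comm_ring_1) mpol" and h :: "'a \<Rightarrow> 'b::field_char_0"
  assumes f: "f \<in> mpols_in {..n}" and h: "\<And>c. h c = 0 \<Longrightarrow> c = 0"
    and 0: "\<And>x. mpol_eval h x f = 0"
  shows "f = 0"
proof -
  define N where "N = Suc (\<Sum>m\<in>Poly_Mapping.keys f. \<Sum>v\<le>n. Poly_Mapping.lookup m v)"
  define code where "code m = (\<Sum>v\<le>n. Poly_Mapping.lookup m v * N ^ v)" for m
  have keys: "Poly_Mapping.keys m \<subseteq> {..n}" if "m \<in> Poly_Mapping.keys f" for m
    using f that by (auto simp: mpols_in_def)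
  have bound: "Poly_Mapping.lookup m v < N" if "m \<in> Poly_Mapping.keys f" "v \<le> n" for m v
  proof -
    have "Poly_Mapping.lookup m v \<le> (\<Sum>v\<le>n. Poly_Mapping.lookup m v)"
      using that by (intro member_le_sum) auto
    also have "\<dots> \<le> (\<Sum>m\<in>Poly_Mapping.keys f. \<Sum>v\<le>n. Poly_Mapping.lookup m v)"
      using that by (intro member_le_sum[where f = "\<lambda>m. \<Sum>v\<le>n. Poly_Mapping.lookup m v"]) auto
    finally show ?thesis by (simp add: N_def)
  qed
  have inj: "m = m'"
    if "m \<in> Poly_Mapping.keys f" "m' \<in> Poly_Mapping.keys f" "code m = code m'" for m m'
  proof (rule poly_mapping_eqI)
    fix v show "Poly_Mapping.lookup m v = Poly_Mapping.lookup m' v"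
    proof (cases "v \<le> n")
      case True
      show ?thesis
        by (rule digits_unique[OF bound bound _ True]) (use that in \<open>auto simp: code_def\<close>)
    next
      case False
      then show ?thesis
        using keys that by (metis atMost_iff in_keys_iff subset_iff)
    qed
  qed
  define p where "p = (\<Sum>m\<in>Poly_Mapping.keys f. Polynomial.monom (h (Poly_Mapping.lookup f m)) (code m))"
  have "poly p t = mpol_eval h (\<lambda>v. t ^ (N ^ v)) f" for t
  proof -
    have "monom_eval (\<lambda>v. t ^ (N ^ v)) m = t ^ code m" if "m \<in> Poly_Mapping.keys f" for m
      using monom_eval_superset[OF _ keys[OF that], of "\<lambda>v. t ^ (N ^ v)"]
      by (simp add: code_def power_sum power_mult[symmetric] mult.commute)
    then show ?thesis
      by (simp add: p_def poly_sum poly_monom mpol_eval_monom_eval)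
  qed
  then have "p = 0"
    using 0 by (simp add: poly_all_0_iff_0[symmetric])
  have "m \<notin> Poly_Mapping.keys f" for m
  proof
    assume m: "m \<in> Poly_Mapping.keys f"
    have "coeff p (code m) = (\<Sum>k\<in>Poly_Mapping.keys f. if k = m then h (Poly_Mapping.lookup f k) else 0)"
      unfolding p_def coeff_sum coeff_monom using inj m by (intro sum.cong) auto
    then have "h (Poly_Mapping.lookup f m) = 0"
      using m \<open>p = 0\<close> by simp
    then show False
      using h m by (simp add: in_keys_iff)
  qed
  then show ?thesis
    by (metis all_not_in_conv keys_eq_empty)
qed

lemma tree_matrix_cong:
  assumes "\<And>k. k \<le> n \<Longrightarrow> y k = y' k"
  shows "tree_matrix n j B y = tree_matrix n j B y'"
  using assms by (intro eq_matI) (auto simp: tree_matrix_def intro!: sum.cong)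

lemma mpol_eval_to_ac: "mpol_eval to_ac (\<lambda>v. to_ac (x v)) f = to_ac (mpol_eval id x f)"
  by (simp add: mpol_eval_def to_ac_sum to_ac_prod)

section \<open>The linear system in adapted coordinates\<close>

text \<open>The linear forms in the first rows of the frames are a basis, with inverse coefficient matrix \<open>T\<close>;
used as coordinates, they turn the second rows into the rows of \<open>B\<close>.\<close>
locale adapted_frames =
  fixes n :: nat and A :: "nat \<Rightarrow> 'k::field_char_0 mat" and T B :: "nat \<Rightarrow> nat \<Rightarrow> 'k"
  assumes n2: "n \<ge> 2"
    and carrier: "\<And>i. i \<le> n \<Longrightarrow> A i \<in> carrier_mat 2 (Suc n)"
    and A_T: "\<And>i k. i \<le> n \<Longrightarrow> k \<le> n \<Longrightarrow> (\<Sum>c\<le>n. A i $$ (0, c) * T c k) = (if i = k then 1 else 0)"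
    and T_A: "\<And>c d. c \<le> n \<Longrightarrow> d \<le> n \<Longrightarrow> (\<Sum>k\<le>n. T c k * A k $$ (0, d)) = (if c = d then 1 else 0)"
    and second_row: "\<And>i c. i \<le> n \<Longrightarrow> c \<le> n \<Longrightarrow> A i $$ (1, c) = (\<Sum>k\<le>n. B i k * A k $$ (0, c))"
    and generic: "generic_matrix n B"
begin

interpretation to_ac: comm_ring_hom "to_ac :: 'k \<Rightarrow> 'k alg_closure"
  by (rule comm_ring_hom_to_ac)

interpretation ev: comm_ring_hom "mpol_eval (to_ac :: 'k \<Rightarrow> 'k alg_closure) x" for x
  by (rule to_ac.mpol_eval_hom)

definition coord :: "(nat \<Rightarrow> 'k alg_closure) \<Rightarrow> nat \<Rightarrow> 'k alg_closure" where
  "coord x i = (\<Sum>c\<le>n. to_ac (A i $$ (0, c)) * x c)"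

definition point :: "(nat \<Rightarrow> 'k alg_closure) \<Rightarrow> nat \<Rightarrow> 'k alg_closure" where
  "point y c = (\<Sum>k\<le>n. to_ac (T c k) * y k)"

definition on_subspace :: "nat \<Rightarrow> (nat \<Rightarrow> 'k alg_closure) \<Rightarrow> bool" where
  "on_subspace i x \<longleftrightarrow> coord x i = 0 \<and> (\<Sum>k\<in>{..n} - {i}. to_ac (B i k) * coord x k) = 0"

text \<open>The equation of \<open>Q\<^sub>j\<close>, over the ground field and in the original coordinates.\<close>
definition Q_form :: "nat \<Rightarrow> (nat, 'k) mpol" where
  "Q_form j = det (tree_matrix n j (\<lambda>i k. Poly_Mapping.single 0 (B i k))
                     (\<lambda>k. linear_form n (\<lambda>c. A k $$ (0, c))))"

lemma coord_point: "i \<le> n \<Longrightarrow> coord (point y) i = y i"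
proof -
  assume i: "i \<le> n"
  have "coord (point y) i = (\<Sum>k\<le>n. (\<Sum>c\<le>n. to_ac (A i $$ (0, c) * T c k)) * y k)"
    unfolding coord_def point_def sum_distrib_left sum_distrib_right
    by (subst sum.swap) (simp add: mult_ac)
  also have "\<dots> = (\<Sum>k\<le>n. if k = i then y k else 0)"
    using i by (intro sum.cong) (auto simp: to_ac_sum[symmetric] A_T simp del: to_ac_mult)
  finally show ?thesis using i by simp
qed

lemma point_coord: "c \<le> n \<Longrightarrow> point (coord x) c = x c"
proof -
  assume c: "c \<le> n"
  have "point (coord x) c = (\<Sum>d\<le>n. (\<Sum>k\<le>n. to_ac (T c k * A k $$ (0, d))) * x d)"
    unfolding coord_def point_def sum_distrib_left sum_distrib_right
    by (subst sum.swap) (simp add: mult_ac)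
  also have "\<dots> = (\<Sum>d\<le>n. if d = c then x d else 0)"
    using c by (intro sum.cong) (auto simp: to_ac_sum[symmetric] T_A simp del: to_ac_mult)
  finally show ?thesis using c by simp
qed

lemma second_row_coord:
  assumes "i \<le> n"
  shows "(\<Sum>c\<le>n. to_ac (A i $$ (1, c)) * x c) = (\<Sum>k\<le>n. to_ac (B i k) * coord x k)"
proof -
  have "(\<Sum>c\<le>n. to_ac (A i $$ (1, c)) * x c) =
      (\<Sum>c\<le>n. \<Sum>k\<le>n. to_ac (B i k) * (to_ac (A k $$ (0, c)) * x c))"
    using assms by (intro sum.cong) (auto simp: second_row[unfolded One_nat_def] to_ac_sum sum_distrib_left mult_ac)
  also have "\<dots> = (\<Sum>k\<le>n. to_ac (B i k) * coord x k)"
    unfolding coord_def sum_distrib_left by (rule sum.swap)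
  finally show ?thesis .
qed

lemma on_subspace_iff:
  assumes "i \<le> n"
  shows "on_subspace i x \<longleftrightarrow> (\<forall>r<2. (\<Sum>c\<le>n. to_ac (A i $$ (r, c)) * x c) = 0)"
proof -
  have "(\<Sum>k\<le>n. to_ac (B i k) * coord x k) = (\<Sum>k\<in>{..n} - {i}. to_ac (B i k) * coord x k)"
    if "coord x i = 0"
    using that assms by (simp add: sum.remove[of "{..n}" i])
  then show ?thesis
    unfolding on_subspace_def using second_row_coord[OF assms, of x]
    by (auto simp: coord_def[symmetric] less_2_cases_iff)
qed

lemma Q_form_in_forms: "j \<le> n \<Longrightarrow> Q_form j \<in> forms n (n - 1)"
  unfolding Q_form_def using n2 by (intro det_tree_matrix_in_forms linear_form_in_forms) auto

lemma eval_Q_form: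
  "mpol_eval to_ac x (Q_form j) = det (tree_matrix n j (\<lambda>i k. to_ac (B i k)) (coord x))"
  unfolding Q_form_def ev.hom_det_tree_matrix
  by (simp add: to_ac.mpol_eval_linear_form coord_def[abs_def])

lemma eval_Q_form_on_subspace:
  assumes "i \<le> n" "j \<le> n" "i \<noteq> j" "on_subspace i x"
  shows "mpol_eval to_ac x (Q_form j) = 0"
  unfolding eval_Q_form using assms n2 by (intro det_tree_matrix_eq_0[of i]) (auto simp: on_subspace_def)

lemma eval_Q_form_unit_point:
  assumes "j \<le> n"
  shows "mpol_eval to_ac (point (unit_point j)) (Q_form j) \<noteq> 0"
proof -
  have "tree_matrix n j (\<lambda>i k. to_ac (B i k)) (coord (point (unit_point j))) =
      tree_matrix n j (\<lambda>i k. to_ac (B i k)) (unit_point j)"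
    by (rule tree_matrix_cong) (simp add: coord_point)
  then show ?thesis
    unfolding eval_Q_form using assms n2 generic_matrix_entry[OF generic]
    by (simp add: det_tree_matrix_unit_point)
qed

lemma eval_point_coord:
  assumes "f \<in> forms n d"
  shows "mpol_eval to_ac (point (coord x)) f = mpol_eval to_ac x f"
  using assms point_coord by (intro mpol_eval_cong[of f "{..n}"]) (auto simp: forms_def)

lemma eval_point_hom_funs:
  assumes "f \<in> forms n d"
  shows "(\<lambda>y. mpol_eval to_ac (point y) f) \<in> hom_funs {..n} d"
  unfolding point_def[abs_def]
  by (rule hom_funs_linear_subst[OF mpol_eval_hom_funs[OF assms]])

lemma generic_to_ac: "generic_matrix n (\<lambda>i k. to_ac (B i k) :: 'k alg_closure)"
  using generic unfolding generic_matrix_def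
  by (simp flip: to_ac_mult to_ac_diff)

lemma hom_funs_eq_0_of_subspaces:
  assumes "G \<in> hom_funs {..n} n" "\<And>i. i \<le> n \<Longrightarrow> G (unit_point i) = 0"
    and "\<And>i y. i \<le> n \<Longrightarrow> on_subspace i (point y) \<Longrightarrow> G y = 0"
  shows "G y = 0"
proof (rule hom_funs_eq_0_of_generic[OF generic_to_ac subset_refl _ assms(1)])
  show "G y = 0" if "i \<in> {..n}" "y i = 0" "(\<Sum>k\<in>{..n} - {i}. to_ac (B i k) * y k) = 0" for i y
    using that by (intro assms(3)[of i]) (auto simp: on_subspace_def coord_point)
qed (use assms(2) in auto)

text \<open>The forms \<open>y\<^sub>j q\<^sub>j\<close> vanish on all subspaces, and \<open>y\<^sub>j q\<^sub>j\<close> is nonzero at the \<open>j\<close>-th vertex of the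
coordinate simplex and zero at the other ones. So each form of the linear system agrees at all vertices
with a combination of them, and forms of the system that vanish at the vertices are zero.\<close>
lemma eval_eq_sum_Q_form:
  assumes f: "f \<in> forms n n"
    and van: "\<And>i x. i \<le> n \<Longrightarrow> on_subspace i x \<Longrightarrow> mpol_eval to_ac x f = 0"
  obtains w where "\<And>x. mpol_eval to_ac x f = (\<Sum>j\<le>n. w j * (coord x j * mpol_eval to_ac x (Q_form j)))"
proof -
  define Q where "Q j y = mpol_eval to_ac (point y) (Q_form j)" for j y
  define w where "w j = mpol_eval to_ac (point (unit_point j)) f / Q j (unit_point j)" for j
  define G where "G y = mpol_eval to_ac (point y) f - (\<Sum>j\<le>n. w j * (y j * Q j y))" for y
  have Q: "(\<lambda>y. y j * Q j y) \<in> hom_funs {..n} n" if "j \<le> n" for j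
    using hom_funs_mult_var[OF eval_point_hom_funs[OF Q_form_in_forms[OF that]], of j] that n2
    by (simp add: Q_def)
  have "(\<lambda>y. 1 * mpol_eval to_ac (point y) f + (- 1) * (\<Sum>j\<le>n. w j * (y j * Q j y))) \<in> hom_funs {..n} n"
    by (intro hom_funs_lincomb eval_point_hom_funs f hom_funs_sum hom_funs_scale Q) simp
  then have G: "G \<in> hom_funs {..n} n"
    by (simp add: G_def[abs_def])
  have "G y = 0" for y
  proof (rule hom_funs_eq_0_of_subspaces[OF G])
    fix i assume i: "i \<le> n"
    have "(\<Sum>j\<le>n. w j * (unit_point i j * Q j (unit_point i))) =
        (\<Sum>j\<le>n. if j = i then w i * Q i (unit_point i) else 0)"
      by (intro sum.cong) auto
    then show "G (unit_point i) = 0"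
      using i eval_Q_form_unit_point[OF i] by (simp add: G_def w_def Q_def)
  next
    fix i y assume i: "i \<le> n" and y: "on_subspace i (point y)"
    have "w j * (y j * Q j y) = 0" if "j \<in> {..n}" for j
    proof (cases "j = i")
      case True
      then show ?thesis
        using y coord_point[OF i, of y] by (simp add: on_subspace_def)
    next
      case False
      then show ?thesis
        using eval_Q_form_on_subspace[OF i _ _ y, of j] that by (simp add: Q_def)
    qed
    then have "(\<Sum>j\<le>n. w j * (y j * Q j y)) = 0"
      by (intro sum.neutral) blast
    then show "G y = 0"
      using van[OF i y] by (simp add: G_def)
  qed
  then have "mpol_eval to_ac (point (coord x)) f =
      (\<Sum>j\<le>n. w j * (coord x j * mpol_eval to_ac (point (coord x)) (Q_form j)))" for x
    by (simp add: G_def Q_def)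
  then have "mpol_eval to_ac x f = (\<Sum>j\<le>n. w j * (coord x j * mpol_eval to_ac x (Q_form j)))" for x
    by (simp add: eval_point_coord[OF f] eval_point_coord[OF Q_form_in_forms])
  then show ?thesis by (rule that)
qed

text \<open>Multiplication by \<open>y\<^sub>j\<close> takes such an \<open>f\<close> into the linear system. There \<open>y\<^sub>j f\<close> vanishes at all
vertices but the \<open>j\<close>-th, hence is a multiple of \<open>y\<^sub>j q\<^sub>j\<close>. The factor is in the ground field because
the vertex is a rational point.\<close>
lemma form_eq_multiple_Q_form:
  assumes f: "f \<in> forms n (n - 1)" and j: "j \<le> n"
    and van: "\<And>i x. i \<le> n \<Longrightarrow> i \<noteq> j \<Longrightarrow> on_subspace i x \<Longrightarrow> mpol_eval to_ac x f = 0"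
  obtains \<mu> where "f = Poly_Mapping.single 0 \<mu> * Q_form j"
proof -
  let ?e = "unit_point j :: nat \<Rightarrow> 'k alg_closure"
  have "point ?e = (\<lambda>c. to_ac (T c j))"
    using j by (auto simp: point_def if_distrib[of "\<lambda>t. _ * t"] cong: if_cong)
  then have rational: "mpol_eval to_ac (point ?e) g = to_ac (mpol_eval id (\<lambda>c. T c j) g)" for g
    by (simp add: mpol_eval_to_ac)
  define \<mu> where "\<mu> = mpol_eval id (\<lambda>c. T c j) f / mpol_eval id (\<lambda>c. T c j) (Q_form j)"
  define h where "h = f + Poly_Mapping.single 0 (- \<mu>) * Q_form j"
  have h: "h \<in> forms n (n - 1)"
    unfolding h_def by (intro forms_add forms_smult f Q_form_in_forms j)
  have eval_h: "mpol_eval to_ac x h = mpol_eval to_ac x f - to_ac \<mu> * mpol_eval to_ac x (Q_form j)" for x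
    by (simp add: h_def to_ac.mpol_eval_add to_ac.mpol_eval_mult)
  define H where "H y = mpol_eval to_ac (point y) h" for y
  have H: "H \<in> hom_funs {..n} (n - 1)"
    unfolding H_def by (rule eval_point_hom_funs[OF h])
  have yH: "y j * H y = 0" for y
  proof (rule hom_funs_eq_0_of_subspaces[of "\<lambda>y. y j * H y"])
    show "(\<lambda>y. y j * H y) \<in> hom_funs {..n} n"
      using hom_funs_mult_var[OF H, of j] j n2 by simp
    show "unit_point i j * H (unit_point i) = 0" if "i \<le> n" for i
    proof (cases "i = j")
      case True
      have "H ?e = 0"
        using eval_Q_form_unit_point[OF j]
        unfolding H_def eval_h rational by (simp add: \<mu>_def)
      then show ?thesis using True by simp
    qed auto
    show "y j * H y = 0" if i: "i \<le> n" and y: "on_subspace i (point y)" for i y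
    proof (cases "i = j")
      case True
      then show ?thesis
        using y coord_point[OF i, of y] by (simp add: on_subspace_def)
    next
      case False
      then show ?thesis
        using van[OF i False y] eval_Q_form_on_subspace[OF i j False y] by (simp add: H_def eval_h)
    qed
  qed
  have "H y = 0" for y
  proof (cases "y j = 0")
    case True
    show ?thesis
    proof (rule hom_funs_eq_0_line[OF H])
      show "H (\<lambda>v. y v + t * ?e v) = 0" if "t \<noteq> 0" for t
        using yH[of "\<lambda>v. y v + t * ?e v"] True that by simp
    qed
  qed (use yH[of y] in auto)
  then have "mpol_eval to_ac x h = 0" for x
    using eval_point_coord[OF h, of x] by (simp add: H_def)
  then have "h = 0"
    using h by (intro mpol_eq_0_if_eval_0[of h n to_ac]) (auto simp: forms_def)
  then have "f = Poly_Mapping.single 0 \<mu> * Q_form j"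
    by (simp add: h_def single_uminus)
  then show ?thesis by (rule that)
qed

end

section \<open>Hypersurfaces and base locus as sets of points\<close>

definition hypersurface_of :: "(nat, 'k::field) mpol \<Rightarrow> (nat, 'k) mpol set" where
  "hypersurface_of f = {Poly_Mapping.map (\<lambda>a. c * a) f | c. c \<noteq> 0}"

lemma hypersurface_of_eq: "hypersurface_of f = {Poly_Mapping.single 0 c * f | c. c \<noteq> 0}"
  unfolding hypersurface_of_def by (simp only: mult_map_scale_conv_mult)

lemma self_in_hypersurface_of: "f \<in> hypersurface_of f"
  unfolding hypersurface_of_eq by (auto intro!: exI[of _ 1])

lemma hypersurface_of_scale:
  assumes "c \<noteq> 0"
  shows "hypersurface_of (Poly_Mapping.single 0 c * f) = hypersurface_of f"
proof -
  have *: "Poly_Mapping.single 0 d * (Poly_Mapping.single 0 c * f) = Poly_Mapping.single 0 (d * c) * f" for d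
    by (simp add: mult.assoc[symmetric] mult_single)
  show ?thesis
  proof (intro equalityI subsetI)
    fix g assume "g \<in> hypersurface_of (Poly_Mapping.single 0 c * f)"
    then obtain d where "d \<noteq> 0" "g = Poly_Mapping.single 0 (d * c) * f"
      by (auto simp: hypersurface_of_eq *)
    then show "g \<in> hypersurface_of f"
      using assms by (auto simp: hypersurface_of_eq intro!: exI[of _ "d * c"])
  next
    fix g assume "g \<in> hypersurface_of f"
    then obtain d where "d \<noteq> 0" "g = Poly_Mapping.single 0 d * f"
      by (auto simp: hypersurface_of_eq)
    then show "g \<in> hypersurface_of (Poly_Mapping.single 0 c * f)"
      using assms by (auto simp: hypersurface_of_eq * intro!: exI[of _ "d / c"])
  qed
qed

lemma vanishes_at_scale:
  "vanishes_at f p \<Longrightarrow> vanishes_at (Poly_Mapping.single 0 c * f) p"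
  unfolding vanishes_at_def
  by (simp add: comm_ring_hom.mpol_eval_mult[OF comm_ring_hom_to_ac])

lemma support_hypersurface_of:
  "support n (hypersurface_of f) = {p \<in> proj_space n. vanishes_at f p}"
  unfolding support_def using self_in_hypersurface_of[of f] vanishes_at_scale[of f]
  by (auto simp: hypersurface_of_eq)

lemma proj_space_representative:
  assumes "p \<in> proj_space n" "x \<in> p"
  shows "x \<in> carrier_vec (Suc n)" "x \<noteq> 0\<^sub>v (Suc n)" "p = proj_pt x"
proof -
  obtain z c where z: "z \<in> carrier_vec (Suc n)" "z \<noteq> 0\<^sub>v (Suc n)" "p = proj_pt z"
    and c: "x = c \<cdot>\<^sub>v z" "c \<noteq> 0"
    using assms by (auto simp: proj_space_def proj_pt_def)
  show "x \<in> carrier_vec (Suc n)" using z c by simp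
  have zx: "z = inverse c \<cdot>\<^sub>v x"
    using z c by (auto simp: smult_smult_assoc)
  then show "x \<noteq> 0\<^sub>v (Suc n)"
    using z by auto
  show "p = proj_pt x"
  proof (intro equalityI subsetI)
    fix u assume "u \<in> p"
    then obtain b where "b \<noteq> 0" "u = b \<cdot>\<^sub>v z" by (auto simp: z(3) proj_pt_def)
    then show "u \<in> proj_pt x"
      using c(2) by (auto simp: proj_pt_def zx smult_smult_assoc intro!: exI[of _ "b * inverse c"])
  next
    fix u assume "u \<in> proj_pt x"
    then obtain b where "b \<noteq> 0" "u = b \<cdot>\<^sub>v x" by (auto simp: proj_pt_def)
    then show "u \<in> p"
      using c by (auto simp: z(3) proj_pt_def smult_smult_assoc intro!: exI[of _ "b * c"])
  qed
qed

lemma proj_pt_in_proj_space: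
  "x \<in> carrier_vec (Suc n) \<Longrightarrow> x \<noteq> 0\<^sub>v (Suc n) \<Longrightarrow> proj_pt x \<in> proj_space n"
  by (simp add: proj_space_def)

lemma self_in_proj_pt: "x \<in> proj_pt x"
  unfolding proj_pt_def by (auto intro!: exI[of _ 1])

lemma in_mat_kernel_iff:
  fixes x :: "'k::field alg_closure vec"
  assumes "M \<in> carrier_mat 2 (Suc n)" "x \<in> carrier_vec (Suc n)"
  shows "x \<in> mat_kernel (map_mat to_ac M) \<longleftrightarrow> (\<forall>r<2. (\<Sum>c\<le>n. to_ac (M $$ (r, c)) * x $ c) = 0)"
proof -
  have "(map_mat to_ac M *\<^sub>v x) $ r = (\<Sum>c\<le>n. to_ac (M $$ (r, c)) * x $ c)" if "r < 2" for r
    using assms that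
    by (auto simp: scalar_prod_def lessThan_Suc_atMost[symmetric] lessThan_atLeast0 intro!: sum.cong)
  then show ?thesis
    using assms by (auto simp: mat_kernel_def vec_eq_iff)
qed

lemma proj_pt_subset_mat_kernel:
  assumes "M \<in> carrier_mat 2 (Suc n)" "x \<in> carrier_vec (Suc n)"
    "x \<in> mat_kernel (map_mat to_ac M)"
  shows "proj_pt x \<subseteq> mat_kernel (map_mat to_ac M)"
proof
  fix z assume "z \<in> proj_pt x"
  then obtain b where "z = b \<cdot>\<^sub>v x" by (auto simp: proj_pt_def)
  then show "z \<in> mat_kernel (map_mat to_ac M)"
    using assms by (auto simp: mat_kernel_def mult_mat_vec[of _ 2 "Suc n"])
qed

lemma in_lin_subspace_iff:
  fixes x :: "'k::field alg_closure vec"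
  assumes "M \<in> carrier_mat 2 (Suc n)" "p \<in> proj_space n" "x \<in> p"
  shows "p \<in> lin_subspace n M \<longleftrightarrow> (\<forall>r<2. (\<Sum>c\<le>n. to_ac (M $$ (r, c)) * x $ c) = 0)"
  using proj_space_representative[OF assms(2,3)] proj_pt_subset_mat_kernel[OF assms(1), of x]
    in_mat_kernel_iff[OF assms(1), of x] assms
  unfolding lin_subspace_def by blast

context adapted_frames
begin

lemma vanishes_on_lin_subspace_iff:
  assumes f: "f \<in> forms n d" "d \<ge> 1" and i: "i \<le> n"
  shows "vanishes_on f (lin_subspace n (A i)) \<longleftrightarrow> (\<forall>x. on_subspace i x \<longrightarrow> mpol_eval to_ac x f = 0)"
proof safe
  fix x assume van: "vanishes_on f (lin_subspace n (A i))" and x: "on_subspace i x"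
  define u where "u = vec (Suc n) x"
  have eval: "mpol_eval to_ac x f = mpol_eval to_ac (\<lambda>c. u $ c) f"
    using f by (intro mpol_eval_cong[of f "{..n}"]) (auto simp: forms_def u_def)
  show "mpol_eval to_ac x f = 0"
  proof (cases "u = 0\<^sub>v (Suc n)")
    case True
    then have "x c = 0" if "c \<le> n" for c
      using that by (metis u_def index_vec index_zero_vec(1) le_imp_less_Suc)
    then show ?thesis
      using hom_funs_eq_0_at_0[of "\<lambda>x. mpol_eval to_ac x f" "{..n}" "d - 1" x]
        mpol_eval_hom_funs[OF f(1), of to_ac] f(2) by simp
  next
    case False
    have up: "proj_pt u \<in> proj_space n"
      using False by (intro proj_pt_in_proj_space) (auto simp: u_def)
    have "(\<Sum>c\<le>n. to_ac (A i $$ (r, c)) * u $ c) = (\<Sum>c\<le>n. to_ac (A i $$ (r, c)) * x c)" for r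
      by (intro sum.cong) (auto simp: u_def)
    then have "proj_pt u \<in> lin_subspace n (A i)"
      using x i carrier[OF i] by (simp add: in_lin_subspace_iff[OF _ up self_in_proj_pt] on_subspace_iff)
    then show ?thesis
      using van self_in_proj_pt[of u] by (simp add: eval vanishes_on_def vanishes_at_def)
  qed
next
  assume "\<forall>x. on_subspace i x \<longrightarrow> mpol_eval to_ac x f = 0"
  moreover have "on_subspace i (\<lambda>c. x $ c)" if "p \<in> lin_subspace n (A i)" "x \<in> p"
    for p and x :: "'k alg_closure vec"
    using in_lin_subspace_iff[OF carrier[OF i] _ that(2)] that(1) i
    by (simp add: on_subspace_iff) (auto simp: lin_subspace_def)
  ultimately show "vanishes_on f (lin_subspace n (A i))"
    by (auto simp: vanishes_on_def vanishes_at_def)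
qed

lemma Q_form_nonzero: "j \<le> n \<Longrightarrow> Q_form j \<noteq> 0"
  using eval_Q_form_unit_point[of j] by (auto simp: mpol_eval_def)

lemma Q_hyp_eq:
  assumes j: "j \<le> n" and P: "\<And>i. i \<le> n \<Longrightarrow> P i = lin_subspace n (A i)"
  shows "Q_hyp n P j = hypersurface_of (Q_form j)"
  unfolding Q_hyp_def
proof (rule the_equality)
  have contains_iff: "P i \<subseteq> support n (hypersurface_of f) \<longleftrightarrow>
      (\<forall>x. on_subspace i x \<longrightarrow> mpol_eval to_ac x f = 0)"
    if "i \<le> n" "f \<in> forms n (n - 1)" for i f
  proof -
    have "P i \<subseteq> support n (hypersurface_of f) \<longleftrightarrow> vanishes_on f (lin_subspace n (A i))"
      by (auto simp: support_hypersurface_of P[OF that(1)] vanishes_on_def lin_subspace_def)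
    then show ?thesis
      using vanishes_on_lin_subspace_iff[OF that(2) _ that(1)] n2 by simp
  qed
  have hyp: "hypersurfaces n (n - 1) = hypersurface_of ` {f \<in> forms n (n - 1). f \<noteq> 0}"
    by (simp add: hypersurfaces_def hypersurface_of_def)
  show "hypersurface_of (Q_form j) \<in> hypersurfaces n (n - 1) \<and>
      (\<forall>i\<le>n. i \<noteq> j \<longrightarrow> P i \<subseteq> support n (hypersurface_of (Q_form j)))"
    using Q_form_in_forms[OF j] Q_form_nonzero[OF j] eval_Q_form_on_subspace[OF _ j]
      contains_iff[OF _ Q_form_in_forms[OF j]]
    unfolding hyp by blast
  fix H assume H: "H \<in> hypersurfaces n (n - 1) \<and> (\<forall>i\<le>n. i \<noteq> j \<longrightarrow> P i \<subseteq> support n H)"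
  then obtain f where f: "H = hypersurface_of f" "f \<in> forms n (n - 1)" "f \<noteq> 0"
    unfolding hyp by blast
  have "mpol_eval to_ac x f = 0" if "i \<le> n" "i \<noteq> j" "on_subspace i x" for i x
    using H f that contains_iff by blast
  then obtain \<mu> where \<mu>: "f = Poly_Mapping.single 0 \<mu> * Q_form j"
    using form_eq_multiple_Q_form[OF f(2) j] by blast
  moreover have "\<mu> \<noteq> 0"
    using \<mu> f(3) by auto
  ultimately show "H = hypersurface_of (Q_form j)"
    by (simp add: f(1) hypersurface_of_scale)
qed

lemma R_locus_eq:
  assumes P: "\<And>i. i \<le> n \<Longrightarrow> P i = lin_subspace n (A i)"
  shows "R_locus n P = {p \<in> proj_space n. \<forall>j\<le>n. vanishes_at (Q_form j) p}"
  unfolding R_locus_def using P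
  by (auto simp: Q_hyp_eq support_hypersurface_of)

lemma lin_system_iff:
  assumes P: "\<And>i. i \<le> n \<Longrightarrow> P i = lin_subspace n (A i)"
  shows "f \<in> lin_system n P \<longleftrightarrow>
    f \<in> forms n n \<and> (\<forall>i\<le>n. \<forall>x. on_subspace i x \<longrightarrow> mpol_eval to_ac x f = 0)"
proof -
  have "vanishes_on f (\<Union>i\<le>n. P i) \<longleftrightarrow> (\<forall>i\<le>n. vanishes_on f (lin_subspace n (A i)))"
    using P by (auto simp: vanishes_on_def)
  then show ?thesis
    using n2 by (auto simp: lin_system_def vanishes_on_lin_subspace_iff)
qed

text \<open>If \<open>p\<close> lies on no \<open>\<Pi>\<^sub>j\<close>, then for each \<open>j\<close> one of the two equations of \<open>\<Pi>\<^sub>j\<close> is nonzero at \<open>p\<close>; its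
product with \<open>q\<^sub>j\<close> is in the linear system, so a base point \<open>p\<close> is on \<open>Q\<^sub>j\<close>. Conversely the linear
system is spanned by multiples of the \<open>q\<^sub>j\<close>.\<close>
theorem base_locus_eq:
  assumes P: "\<And>i. i \<le> n \<Longrightarrow> P i = lin_subspace n (A i)"
  shows "base_locus n P = (\<Union>i\<le>n. P i) \<union> R_locus n P"
proof (intro equalityI subsetI)
  fix p assume p: "p \<in> base_locus n P"
  then have pp: "p \<in> proj_space n"
    and van: "\<And>f (x :: 'k alg_closure vec). f \<in> lin_system n P \<Longrightarrow> x \<in> p \<Longrightarrow> mpol_eval to_ac (\<lambda>c. x $ c) f = 0"
    by (auto simp: base_locus_def vanishes_at_def)
  show "p \<in> (\<Union>i\<le>n. P i) \<union> R_locus n P"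
  proof (rule ccontr)
    assume np: "p \<notin> (\<Union>i\<le>n. P i) \<union> R_locus n P"
    then obtain j and x :: "'k alg_closure vec" where j: "j \<le> n" "x \<in> p" "mpol_eval to_ac (\<lambda>c. x $ c) (Q_form j) \<noteq> 0"
      using pp by (auto simp: R_locus_eq[OF P] vanishes_at_def)
    have "p \<notin> lin_subspace n (A j)"
      using np j(1) P by auto
    then obtain r where r: "r < 2" "(\<Sum>c\<le>n. to_ac (A j $$ (r, c)) * x $ c) \<noteq> 0"
      using in_lin_subspace_iff[OF carrier[OF j(1)] pp j(2)] by blast
    define f where "f = linear_form n (\<lambda>c. A j $$ (r, c)) * Q_form j"
    have eval_f: "mpol_eval to_ac z f =
        (\<Sum>c\<le>n. to_ac (A j $$ (r, c)) * z c) * mpol_eval to_ac z (Q_form j)" for z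
      by (simp add: f_def comm_ring_hom.mpol_eval_mult[OF comm_ring_hom_to_ac]
          comm_ring_hom.mpol_eval_linear_form[OF comm_ring_hom_to_ac])
    have "f \<in> forms n n"
      using forms_mult[OF linear_form_in_forms Q_form_in_forms[OF j(1)]] n2 by (simp add: f_def)
    moreover have "mpol_eval to_ac z f = 0" if i: "i \<le> n" "on_subspace i z" for i z
    proof (cases "i = j")
      case True
      then show ?thesis using i r(1) by (simp add: eval_f on_subspace_iff)
    next
      case False
      then show ?thesis using i j(1) by (simp add: eval_f eval_Q_form_on_subspace)
    qed
    ultimately have "f \<in> lin_system n P"
      by (simp add: lin_system_iff[OF P])
    then show False
      using van[of f x] j(2) r(2) j(3) by (simp add: eval_f)
  qed
next
  fix p assume "p \<in> (\<Union>i\<le>n. P i) \<union> R_locus n P"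
  then consider i where "i \<le> n" "p \<in> P i" | "p \<in> R_locus n P" by blast
  then show "p \<in> base_locus n P"
  proof cases
    case 1
    then show ?thesis
      using P by (auto simp: base_locus_def lin_system_def vanishes_on_def lin_subspace_def)
  next
    case 2
    have "mpol_eval to_ac (\<lambda>c. x $ c) f = 0" if f: "f \<in> lin_system n P" and x: "x \<in> p"
      for f and x :: "'k alg_closure vec"
    proof -
      have "f \<in> forms n n" "\<And>i x. i \<le> n \<Longrightarrow> on_subspace i x \<Longrightarrow> mpol_eval to_ac x f = 0"
        using f lin_system_iff[OF P] by blast+
      then obtain w where "\<And>x. mpol_eval to_ac x f =
          (\<Sum>j\<le>n. w j * (coord x j * mpol_eval to_ac x (Q_form j)))"
        using eval_eq_sum_Q_form by blast
      then show ?thesis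
        using 2 x by (simp add: R_locus_eq[OF P] vanishes_at_def)
    qed
    then show ?thesis
      using 2 by (auto simp: base_locus_def R_locus_eq[OF P] vanishes_at_def)
  qed
qed

end

section \<open>Frames of the same subspace\<close>

definition minor2 :: "'a::comm_ring_1 mat \<Rightarrow> nat \<Rightarrow> nat \<Rightarrow> 'a" where
  "minor2 M p q = M $$ (0, p) * M $$ (1, q) - M $$ (0, q) * M $$ (1, p)"

text \<open>The columns \<open>p\<close> and \<open>q\<close> are independent, and there are never more than two independent vectors of
length two.\<close>
lemma rank_2_if_minor2:
  fixes M :: "'k::field mat"
  assumes M: "M \<in> carrier_mat 2 N" and pq: "p < N" "q < N" "minor2 M p q \<noteq> 0"
  shows "vec_space.rank 2 M = 2"
proof -
  interpret vec_space "TYPE('k)" 2 .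
  define C where "C = mat_of_cols 2 [col M p, col M q]"
  have C: "C \<in> carrier_mat 2 2"
    using mat_of_cols_carrier[of 2 "[col M p, col M q]"] by (simp add: C_def numeral_2_eq_2)
  have cols: "cols C = [col M p, col M q]"
    using M unfolding C_def by (intro cols_mat_of_cols) (auto intro!: carrier_vecI)
  have "det C = (\<Sum>i<2. C $$ (i, 0) * cofactor C i 0)"
    by (rule laplace_expansion_column[OF C]) simp
  also have "\<dots> = minor2 M p q"
    using M pq
    by (simp add: cofactor_def mat_delete_def det_single numeral_2_eq_2 C_def mat_of_cols_def minor2_def)
  finally have "det C = minor2 M p q" .
  then have rank_C: "rank C = 2"
    using pq(3) low_rank_det_zero[OF C] by simp
  have dist: "distinct (cols C)"
  proof (rule ccontr)
    assume "\<not> distinct (cols C)"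
    then show False using non_distinct_low_rank[OF C] rank_C by simp
  qed
  have "lin_indpt (set (cols C))"
    by (rule full_rank_lin_indpt[OF C rank_C dist])
  moreover have "set (cols C) \<subseteq> set (cols M)"
    using M pq unfolding cols by (auto simp: cols_def)
  ultimately have "card (set (cols C)) \<le> rank M"
    by (intro rank_ge_card_indpt[OF M])
  then have ge: "2 \<le> rank M"
    using distinct_card[OF dist] cols by simp
  obtain S where S: "maximal S (\<lambda>T. T \<subseteq> set (cols M) \<and> lin_indpt T)"
    using maximal_exists[of "(\<lambda>T. T \<subseteq> set (cols M) \<and> lin_indpt T)" "card (set (cols M))" "{}"]
    by (meson List.finite_set card_mono empty_iff empty_subsetI finite_lin_indpt2 rev_finite_subset)
  then have "S \<subseteq> carrier_vec 2" "lin_indpt S"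
    using cols_dim[of M] M by (auto simp: maximal_def)
  then have "card S \<le> 2"
    using li_le_dim(2)[of S] fin_dim dim_is_n by simp
  then show ?thesis
    using ge rank_card_indpt[OF M S] by simp
qed

lemma frames2_iff:
  "M \<in> frames2 n \<longleftrightarrow> M \<in> carrier_mat 2 (Suc n) \<and> (\<exists>p\<le>n. \<exists>q\<le>n. minor2 M p q \<noteq> 0)"
proof safe
  assume M: "M \<in> frames2 n"
  then show carr: "M \<in> carrier_mat 2 (Suc n)"
    by (simp add: frames2_def)
  show "\<exists>p\<le>n. \<exists>q\<le>n. minor2 M p q \<noteq> 0"
  proof (rule ccontr)
    assume "\<not> (\<exists>p\<le>n. \<exists>q\<le>n. minor2 M p q \<noteq> 0)"
    then have *: "M $$ (0, p) * M $$ (1, q) = M $$ (0, q) * M $$ (1, p)" if "p \<le> n" "q \<le> n" for p q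
      using that by (auto simp: minor2_def)
    interpret vec_space "TYPE('a)" 2 .
    have "\<exists>f g. \<forall>r<2. \<forall>c\<le>n. M $$ (r, c) = f r * g c"
    proof (cases "\<forall>r<2. \<forall>c\<le>n. M $$ (r, c) = 0")
      case True
      then show ?thesis by (intro exI[of _ "\<lambda>_. 0"]) auto
    next
      case False
      then obtain r c where rc: "r < 2" "c \<le> n" "M $$ (r, c) \<noteq> 0" by blast
      have "M $$ (s, d) = M $$ (s, c) / M $$ (r, c) * M $$ (r, d)" if "s < 2" "d \<le> n" for s d
        using *[OF rc(2) that(2)] rc that by (auto simp: less_2_cases_iff field_simps)
      then show ?thesis by (intro exI[of _ "\<lambda>s. M $$ (s, c) / M $$ (r, c)"] exI[of _ "\<lambda>d. M $$ (r, d)"]) auto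
    qed
    then obtain f g where "\<And>r c. r < 2 \<Longrightarrow> c \<le> n \<Longrightarrow> M $$ (r, c) = f r * g c" by blast
    then have "rank M \<le> 1"
      using carr by (intro rank_le_1_product_entries[OF carr, of f g]) auto
    then show False
      using M by (simp add: frames2_def)
  qed
next
  fix p q assume "M \<in> carrier_mat 2 (Suc n)" "p \<le> n" "q \<le> n" "minor2 M p q \<noteq> 0"
  then show "M \<in> frames2 n"
    using rank_2_if_minor2[of M "Suc n" p q] by (simp add: frames2_def)
qed

definition row_change :: "(nat \<Rightarrow> nat \<Rightarrow> 'a::comm_ring_1) \<Rightarrow> (nat \<Rightarrow> nat \<Rightarrow> 'a) \<Rightarrow> nat \<Rightarrow> nat \<Rightarrow> 'a" where
  "row_change m a r c = m r 0 * a 0 c + m r 1 * a 1 c"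

definition det2 :: "(nat \<Rightarrow> nat \<Rightarrow> 'a::comm_ring_1) \<Rightarrow> 'a" where
  "det2 m = m 0 0 * m 1 1 - m 0 1 * m 1 0"

lemma minor2_row_change:
  assumes "\<And>r c. r < 2 \<Longrightarrow> c \<le> n \<Longrightarrow> M' $$ (r, c) = row_change m (\<lambda>r c. M $$ (r, c)) r c"
    and "p \<le> n" "q \<le> n"
  shows "minor2 M' p q = det2 m * minor2 M p q"
  using assms by (simp add: minor2_def det2_def row_change_def algebra_simps)

lemma lin_subspace_row_change:
  fixes M M' :: "'k::field mat"
  assumes M: "M \<in> carrier_mat 2 (Suc n)" "M' \<in> carrier_mat 2 (Suc n)"
    and row: "\<And>r c. r < 2 \<Longrightarrow> c \<le> n \<Longrightarrow> M' $$ (r, c) = row_change m (\<lambda>r c. M $$ (r, c)) r c"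
    and m: "det2 m \<noteq> 0"
  shows "lin_subspace n M' = lin_subspace n M"
proof -
  have "p \<in> lin_subspace n M' \<longleftrightarrow> p \<in> lin_subspace n M" if p: "p \<in> proj_space n" for p
  proof -
    obtain x where x: "x \<in> p"
      using p self_in_proj_pt by (auto simp: proj_space_def)
    define l where "l r = (\<Sum>c\<le>n. to_ac (M $$ (r, c)) * x $ c)" for r
    have row_sum: "(\<Sum>c\<le>n. to_ac (M' $$ (r, c)) * x $ c) = to_ac (m r 0) * l 0 + to_ac (m r 1) * l 1"
      if "r < 2" for r
    proof -
      have "(\<Sum>c\<le>n. to_ac (M' $$ (r, c)) * x $ c) =
          (\<Sum>c\<le>n. to_ac (m r 0) * (to_ac (M $$ (0, c)) * x $ c) + to_ac (m r 1) * (to_ac (M $$ (1, c)) * x $ c))"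
        using that by (intro sum.cong) (auto simp: row row_change_def algebra_simps)
      then show ?thesis
        by (simp add: l_def sum.distrib sum_distrib_left)
    qed
    define e where "e r = to_ac (m r 0) * l 0 + to_ac (m r 1) * l 1" for r
    have "to_ac (det2 m) * l 0 = to_ac (m 1 1) * e 0 - to_ac (m 0 1) * e 1"
      "to_ac (det2 m) * l 1 = to_ac (m 0 0) * e 1 - to_ac (m 1 0) * e 0"
      by (simp_all add: det2_def e_def algebra_simps)
    then have "l 0 = 0 \<and> l 1 = 0" if "e 0 = 0" "e 1 = 0"
      using m that by simp
    then have "l 0 = 0 \<and> l 1 = 0 \<longleftrightarrow> e 0 = 0 \<and> e 1 = 0"
      by (auto simp: e_def)
    then have "(\<forall>r<2. l r = 0) \<longleftrightarrow> (\<forall>r<2. (\<Sum>c\<le>n. to_ac (M' $$ (r, c)) * x $ c) = 0)"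
      using row_sum[of 0] row_sum[of 1] by (auto simp: less_2_cases_iff e_def)
    then show ?thesis
      by (simp add: in_lin_subspace_iff[OF M(1) p x] in_lin_subspace_iff[OF M(2) p x] l_def)
  qed
  then show ?thesis
    by (auto simp: lin_subspace_def)
qed

text \<open>If the minor of \<open>M\<close> in the columns \<open>p\<close> and \<open>q\<close> is nonzero, Cramer's rule gives the only \<open>m\<close> that is
right in these two columns. For any other column \<open>c\<close> the kernel of \<open>M\<close> contains a vector supported on
\<open>{c, p, q}\<close>, and as it is killed by \<open>M'\<close> as well, \<open>m\<close> is right in column \<open>c\<close> too.\<close>
lemma row_change_if_lin_subspace_subset:
  fixes M M' :: "'k::field mat"
  assumes M: "M \<in> frames2 n" and M': "M' \<in> frames2 n"
    and sub: "lin_subspace n M \<subseteq> lin_subspace n M'"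
  obtains m where "det2 m \<noteq> 0"
    "\<And>r c. r < 2 \<Longrightarrow> c \<le> n \<Longrightarrow> M' $$ (r, c) = row_change m (\<lambda>r c. M $$ (r, c)) r c"
proof -
  have carr: "M \<in> carrier_mat 2 (Suc n)" "M' \<in> carrier_mat 2 (Suc n)"
    using M M' by (auto simp: frames2_def)
  obtain p q where pq: "p \<le> n" "q \<le> n" "minor2 M p q \<noteq> 0"
    using M by (auto simp: frames2_iff)
  have ker: "(\<Sum>c\<le>n. M' $$ (r, c) * v c) = 0"
    if v: "\<And>r. r < 2 \<Longrightarrow> (\<Sum>c\<le>n. M $$ (r, c) * v c) = 0" and r: "r < 2" for v r
  proof (cases "\<forall>c\<le>n. v c = 0")
    case False
    define u where "u = vec (Suc n) (\<lambda>c. to_ac (v c))"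
    have eq: "(\<Sum>c\<le>n. to_ac (N $$ (s, c)) * u $ c) = to_ac (\<Sum>c\<le>n. N $$ (s, c) * v c)" for N :: "'k mat" and s
      by (simp add: u_def to_ac_sum)
    obtain c where "c \<le> n" "v c \<noteq> 0" using False by blast
    then have "u $ c \<noteq> 0"
      by (simp add: u_def)
    then have "u \<noteq> 0\<^sub>v (Suc n)"
      using \<open>c \<le> n\<close> by auto
    then have u: "proj_pt u \<in> proj_space n"
      by (intro proj_pt_in_proj_space) (auto simp: u_def)
    have "proj_pt u \<in> lin_subspace n M"
      unfolding in_lin_subspace_iff[OF carr(1) u self_in_proj_pt] eq using v by simp
    then have "proj_pt u \<in> lin_subspace n M'"
      using sub by blast
    then show ?thesis
      unfolding in_lin_subspace_iff[OF carr(2) u self_in_proj_pt] eq using r by simp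
  qed auto
  define m where "m r s = (if s = 0 then M' $$ (r, p) * M $$ (1, q) - M' $$ (r, q) * M $$ (1, p)
      else M $$ (0, p) * M' $$ (r, q) - M $$ (0, q) * M' $$ (r, p)) / minor2 M p q" for r s :: nat
  have row: "M' $$ (r, c) = row_change m (\<lambda>r c. M $$ (r, c)) r c" if r: "r < 2" and c: "c \<le> n" for r c
  proof -
    \<comment> \<open>The kernel vector is given by the relation between three columns of length two;
      it is zero for \<open>c = p\<close> and \<open>c = q\<close>, so these columns need no separate treatment.\<close>
    define v where "v d = (if d = c then minor2 M p q else 0) - (if d = p then minor2 M c q else 0)
      - (if d = q then minor2 M p c else 0)" for d
    have sum_v: "(\<Sum>d\<le>n. N $$ (s, d) * v d) =
        N $$ (s, c) * minor2 M p q - N $$ (s, p) * minor2 M c q - N $$ (s, q) * minor2 M p c"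
      for N :: "'k mat" and s
      using pq c by (simp add: v_def right_diff_distrib sum_subtractf if_distrib[of "\<lambda>t. _ * t"] cong: if_cong)
    have "(\<Sum>d\<le>n. M $$ (s, d) * v d) = 0" if "s < 2" for s
      unfolding sum_v using that by (auto simp: less_2_cases_iff minor2_def algebra_simps)
    then have "M' $$ (r, c) * minor2 M p q = M' $$ (r, p) * minor2 M c q + M' $$ (r, q) * minor2 M p c"
      using ker[of v r] r unfolding sum_v by (simp add: algebra_simps)
    also have "\<dots> = row_change m (\<lambda>r c. M $$ (r, c)) r c * minor2 M p q"
      using pq(3) by (simp add: row_change_def m_def add_divide_distrib[symmetric]) (simp add: minor2_def algebra_simps)
    finally show ?thesis
      using pq(3) by simp
  qed
  obtain p' q' where "p' \<le> n" "q' \<le> n" "minor2 M' p' q' \<noteq> 0"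
    using M' by (auto simp: frames2_iff)
  then have "det2 m \<noteq> 0"
    using minor2_row_change[OF row] by fastforce
  then show ?thesis
    using row by (rule that)
qed

section \<open>Polynomial functions on affine space\<close>

definition polyfun :: "'v set \<Rightarrow> (('v \<Rightarrow> 'k::comm_ring_1) \<Rightarrow> 'k) \<Rightarrow> bool" where
  "polyfun V F \<longleftrightarrow> (\<exists>f\<in>mpols_in V. \<forall>z. F z = mpol_eval id z f)"

lemma polyfun_const: "polyfun V (\<lambda>z. c)"
  unfolding polyfun_def
  by (intro bexI[of _ "Poly_Mapping.single 0 c"])
     (auto simp: comm_ring_hom.mpol_eval_const[OF comm_ring_hom_id] mpols_in_single)

lemma polyfun_var: "v \<in> V \<Longrightarrow> polyfun V (\<lambda>z. z v)"
  unfolding polyfun_def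
  by (intro bexI[of _ "Poly_Mapping.single (Poly_Mapping.single v 1) 1"])
     (auto simp: comm_ring_hom.mpol_eval_single[OF comm_ring_hom_id] intro!: mpols_in_single)

lemma polyfun_add:
  assumes "polyfun V F" "polyfun V G"
  shows "polyfun V (\<lambda>z. F z + G z)"
proof -
  obtain f g where "f \<in> mpols_in V" "\<And>z. F z = mpol_eval id z f"
    "g \<in> mpols_in V" "\<And>z. G z = mpol_eval id z g"
    using assms by (auto simp: polyfun_def)
  then show ?thesis
    unfolding polyfun_def
    by (intro bexI[of _ "f + g"])
       (auto simp: comm_ring_hom.mpol_eval_add[OF comm_ring_hom_id] mpols_in_add)
qed

lemma polyfun_mult:
  assumes "polyfun V F" "polyfun V G"
  shows "polyfun V (\<lambda>z. F z * G z)"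
proof -
  obtain f g where "f \<in> mpols_in V" "\<And>z. F z = mpol_eval id z f"
    "g \<in> mpols_in V" "\<And>z. G z = mpol_eval id z g"
    using assms by (auto simp: polyfun_def)
  then show ?thesis
    unfolding polyfun_def
    by (intro bexI[of _ "f * g"])
       (auto simp: comm_ring_hom.mpol_eval_mult[OF comm_ring_hom_id] mpols_in_mult)
qed

lemma polyfun_diff:
  assumes "polyfun V F" "polyfun V G"
  shows "polyfun V (\<lambda>z. F z - G z)"
  using polyfun_add[OF assms(1) polyfun_mult[OF polyfun_const assms(2)], of "- 1"] by simp

lemma polyfun_sum: "(\<And>i. i \<in> I \<Longrightarrow> polyfun V (F i)) \<Longrightarrow> polyfun V (\<lambda>z. \<Sum>i\<in>I. F i z)"
  by (induction I rule: infinite_finite_induct) (auto intro: polyfun_const polyfun_add)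

lemma polyfun_prod: "(\<And>i. i \<in> I \<Longrightarrow> polyfun V (F i)) \<Longrightarrow> polyfun V (\<lambda>z. \<Prod>i\<in>I. F i z)"
  by (induction I rule: infinite_finite_induct) (auto intro: polyfun_const polyfun_mult)

lemma polyfun_det:
  assumes "\<And>z. N z \<in> carrier_mat d d"
    and "\<And>i k. i < d \<Longrightarrow> k < d \<Longrightarrow> polyfun V (\<lambda>z. N z $$ (i, k))"
  shows "polyfun V (\<lambda>z. det (N z))"
  unfolding det_def'[OF assms(1)]
proof (intro polyfun_sum polyfun_mult polyfun_const polyfun_prod assms(2))
  fix p i assume "p \<in> {p. p permutes {0..<d}}" "i \<in> {0..<d}"
  then show "i < d" "p i < d"
    using permutes_in_image[of p "{0..<d}" i] by auto
qed

lemma polyfun_line: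
  assumes "polyfun V F"
  shows "\<exists>p. \<forall>t. F (\<lambda>v. z v + t * w v) = poly p t"
proof -
  obtain f where f: "\<And>z. F z = mpol_eval id z f"
    using assms by (auto simp: polyfun_def)
  show ?thesis
    by (rule exI[of _ "\<Sum>m\<in>Poly_Mapping.keys f. [:Poly_Mapping.lookup f m:] *
          (\<Prod>v\<in>Poly_Mapping.keys m. [:z v, w v:] ^ Poly_Mapping.lookup m v)"])
       (simp add: f mpol_eval_def poly_sum poly_prod poly_power)
qed

text \<open>Irreducibility of affine space, by restriction to the line through a point where \<open>F\<close> is nonzero and
a point where \<open>G\<close> is nonzero.\<close>
lemma polyfun_common_nonzero:
  fixes F G :: "('v \<Rightarrow> 'k::field_char_0) \<Rightarrow> 'k"
  assumes "polyfun V F" "polyfun V G" "F z \<noteq> 0" "G w \<noteq> 0"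
  obtains u where "F u \<noteq> 0" "G u \<noteq> 0"
proof -
  let ?l = "\<lambda>t v. z v + t * (w v - z v)"
  obtain p q where p: "\<And>t. F (?l t) = poly p t" and q: "\<And>t. G (?l t) = poly q t"
    using polyfun_line[OF assms(1), of z "\<lambda>v. w v - z v"]
      polyfun_line[OF assms(2), of z "\<lambda>v. w v - z v"] by metis
  have "p \<noteq> 0" "q \<noteq> 0"
    using p[of 0] q[of 1] assms(3,4) by auto
  then have "finite {t. poly (p * q) t = 0}"
    by (intro poly_roots_finite) simp
  then obtain t where "poly (p * q) t \<noteq> 0"
    using infinite_UNIV_char_0[where 'a = 'k] by (metis (mono_tags, lifting) UNIV_eq_I mem_Collect_eq)
  then show ?thesis
    using that[of "?l t"] by (simp add: p q)
qed

section \<open>The genericity condition\<close>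

definition first_rows :: "nat \<Rightarrow> (nat \<times> nat \<times> nat \<Rightarrow> 'k) \<Rightarrow> 'k mat" where
  "first_rows n z = mat (Suc n) (Suc n) (\<lambda>(i, c). z (i, 0, c))"

text \<open>By Cramer's rule, the coefficients of the second row of the \<open>i\<close>-th frame in the basis given by the first
rows, multiplied by the determinant of this basis to make them polynomial.\<close>
definition cramer_coeff :: "nat \<Rightarrow> (nat \<times> nat \<times> nat \<Rightarrow> 'k::comm_ring_1) \<Rightarrow> nat \<Rightarrow> nat \<Rightarrow> 'k" where
  "cramer_coeff n z i k = (\<Sum>c\<le>n. z (i, 1, c) * cofactor (first_rows n z) k c)"

definition distinct_quadruples :: "nat \<Rightarrow> (nat \<times> nat \<times> nat \<times> nat) set" where
  "distinct_quadruples n = {(i, j, k, l). i \<le> n \<and> j \<le> n \<and> k \<le> n \<and> l \<le> n \<and> distinct [i, j, k, l]}"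

definition genericity :: "nat \<Rightarrow> (nat \<times> nat \<times> nat \<Rightarrow> 'k::comm_ring_1) \<Rightarrow> 'k" where
  "genericity n z = det (first_rows n z) *
     (\<Prod>i\<le>n. \<Prod>k\<in>{..n} - {i}. cramer_coeff n z i k) *
     (\<Prod>(i, j, k, l)\<in>distinct_quadruples n.
        cramer_coeff n z i k * cramer_coeff n z j l - cramer_coeff n z i l * cramer_coeff n z j k)"

abbreviation frame_coords :: "nat \<Rightarrow> (nat \<times> nat \<times> nat) set" where
  "frame_coords n \<equiv> {..n} \<times> {..<2} \<times> {..n}"

definition entries :: "(nat \<Rightarrow> 'k mat) \<Rightarrow> nat \<times> nat \<times> nat \<Rightarrow> 'k" where
  "entries A = (\<lambda>(i, r, c). A i $$ (r, c))"

lemma entries_apply: "entries A (i, r, c) = A i $$ (r, c)"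
  by (simp add: entries_def)

lemma finite_distinct_quadruples: "finite (distinct_quadruples n)"
  by (rule finite_subset[of _ "{..n} \<times> {..n} \<times> {..n} \<times> {..n}"]) (auto simp: distinct_quadruples_def)

lemma first_rows_carrier [simp]: "first_rows n z \<in> carrier_mat (Suc n) (Suc n)"
  by (simp add: first_rows_def)

lemma genericity_cong:
  assumes "\<And>v. v \<in> frame_coords n \<Longrightarrow> z v = w v"
  shows "genericity n z = genericity n w"
proof -
  have a: "first_rows n z = first_rows n w"
    using assms by (intro eq_matI) (auto simp: first_rows_def)
  have "cramer_coeff n z i k = cramer_coeff n w i k" if "i \<le> n" for i k
    using assms that unfolding cramer_coeff_def a by (intro sum.cong) auto
  then show ?thesis
    unfolding genericity_def a
    by (intro arg_cong2[where f = "(*)"] prod.cong refl) (auto simp: distinct_quadruples_def)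
qed

lemma polyfun_genericity:
  assumes S: "\<And>v. v \<in> frame_coords n \<Longrightarrow> polyfun V (\<lambda>z. S z v)"
  shows "polyfun V (\<lambda>z. genericity n (S z))"
proof -
  have "polyfun V (\<lambda>z. cofactor (first_rows n (S z)) k c)" if "k \<le> n" "c \<le> n" for k c
    unfolding cofactor_def using that
    by (intro polyfun_mult polyfun_const polyfun_det[where d = n])
       (auto simp: mat_delete_def first_rows_def intro!: S)
  then have cramer: "polyfun V (\<lambda>z. cramer_coeff n (S z) i k)" if "i \<le> n" "k \<le> n" for i k
    unfolding cramer_coeff_def using that by (intro polyfun_sum polyfun_mult S) auto
  have "polyfun V (\<lambda>z. det (first_rows n (S z)))"
    by (intro polyfun_det[where d = "Suc n"]) (auto simp: first_rows_def intro!: S)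
  then show ?thesis
    unfolding genericity_def case_prod_unfold
    by (intro polyfun_mult polyfun_prod polyfun_diff cramer) (auto simp: distinct_quadruples_def)
qed

lemma first_rows_cofactors:
  fixes z :: "nat \<times> nat \<times> nat \<Rightarrow> 'k::comm_ring_1"
  assumes "i \<le> n" "k \<le> n"
  shows "(\<Sum>c\<le>n. z (i, 0, c) * cofactor (first_rows n z) k c) = (if i = k then det (first_rows n z) else 0)"
    and "(\<Sum>c\<le>n. cofactor (first_rows n z) c i * z (c, 0, k)) = (if i = k then det (first_rows n z) else 0)"
proof -
  let ?a = "first_rows n z"
  have "(?a * adj_mat ?a) $$ (i, k) = (det ?a \<cdot>\<^sub>m 1\<^sub>m (Suc n)) $$ (i, k)"
    "(adj_mat ?a * ?a) $$ (i, k) = (det ?a \<cdot>\<^sub>m 1\<^sub>m (Suc n)) $$ (i, k)"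
    using adj_mat[OF first_rows_carrier[of n z]] by simp_all
  moreover have "(?a * adj_mat ?a) $$ (i, k) = (\<Sum>c\<le>n. z (i, 0, c) * cofactor ?a k c)"
    "(adj_mat ?a * ?a) $$ (i, k) = (\<Sum>c\<le>n. cofactor ?a c i * z (c, 0, k))"
    using assms by (auto simp: first_rows_def adj_mat_def scalar_prod_def lessThan_Suc_atMost[symmetric]
        lessThan_atLeast0 intro!: sum.cong)
  ultimately show
    "(\<Sum>c\<le>n. z (i, 0, c) * cofactor ?a k c) = (if i = k then det ?a else 0)"
    "(\<Sum>c\<le>n. cofactor ?a c i * z (c, 0, k)) = (if i = k then det ?a else 0)"
    using assms by auto
qed

lemma genericity_nonzero_iff:
  fixes z :: "nat \<times> nat \<times> nat \<Rightarrow> 'k::field"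
  shows "genericity n z \<noteq> 0 \<longleftrightarrow> det (first_rows n z) \<noteq> 0 \<and> generic_matrix n (cramer_coeff n z)"
proof -
  let ?B = "cramer_coeff n z"
  have "(\<Prod>(i, j, k, l)\<in>distinct_quadruples n. ?B i k * ?B j l - ?B i l * ?B j k) \<noteq> 0 \<longleftrightarrow>
      (\<forall>(i, j, k, l)\<in>distinct_quadruples n. ?B i k * ?B j l - ?B i l * ?B j k \<noteq> 0)"
    by (simp add: prod_zero_iff[OF finite_distinct_quadruples] case_prod_unfold)
  also have "\<dots> \<longleftrightarrow> (\<forall>i\<le>n. \<forall>j\<le>n. \<forall>k\<le>n. \<forall>l\<le>n. distinct [i, j, k, l] \<longrightarrow>
      ?B i k * ?B j l - ?B i l * ?B j k \<noteq> 0)"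
    unfolding distinct_quadruples_def by blast
  finally show ?thesis
    unfolding genericity_def generic_matrix_def mult_eq_0_iff de_Morgan_disj
    by (auto simp: prod_zero_iff)
qed

lemma adapted_frames_if_genericity:
  fixes A :: "nat \<Rightarrow> 'k::field_char_0 mat"
  assumes "n \<ge> 2" and A: "\<And>i. i \<le> n \<Longrightarrow> A i \<in> carrier_mat 2 (Suc n)"
    and nz: "genericity n (entries A) \<noteq> 0"
  obtains T B where "adapted_frames n A T B"
proof -
  let ?z = "entries A"
  define D where "D = det (first_rows n ?z)"
  have D: "D \<noteq> 0" and gen: "generic_matrix n (cramer_coeff n ?z)"
    using nz by (auto simp: genericity_nonzero_iff D_def)
  define T where "T c k = cofactor (first_rows n ?z) k c / D" for c k
  define B where "B i k = cramer_coeff n ?z i k / D" for i k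
  have A_T: "(\<Sum>c\<le>n. A i $$ (0, c) * T c k) = (if i = k then 1 else 0)" if "i \<le> n" "k \<le> n" for i k
    using first_rows_cofactors(1)[OF that, of ?z] D
    by (simp add: T_def entries_apply D_def[symmetric] sum_divide_distrib[symmetric])
  have T_A: "(\<Sum>k\<le>n. T c k * A k $$ (0, d)) = (if c = d then 1 else 0)" if "c \<le> n" "d \<le> n" for c d
    using first_rows_cofactors(2)[OF that, of ?z] D
    by (simp add: T_def entries_apply D_def[symmetric] sum_divide_distrib[symmetric])
  have second: "A i $$ (1, c) = (\<Sum>k\<le>n. B i k * A k $$ (0, c))" if "i \<le> n" "c \<le> n" for i c
  proof -
    have "(\<Sum>k\<le>n. B i k * A k $$ (0, c)) = (\<Sum>k\<le>n. (\<Sum>d\<le>n. A i $$ (1, d) * T d k) * A k $$ (0, c))"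
      by (simp add: B_def T_def cramer_coeff_def entries_apply sum_divide_distrib)
    also have "\<dots> = (\<Sum>d\<le>n. A i $$ (1, d) * (\<Sum>k\<le>n. T d k * A k $$ (0, c)))"
      unfolding sum_distrib_left sum_distrib_right by (subst sum.swap) (simp add: mult_ac)
    also have "\<dots> = (\<Sum>d\<le>n. if d = c then A i $$ (1, d) else 0)"
      using that by (intro sum.cong) (auto simp: T_A)
    finally show ?thesis using that by simp
  qed
  have "generic_matrix n B"
  proof -
    have "B i k * B j l - B i l * B j k = (cramer_coeff n ?z i k * cramer_coeff n ?z j l -
        cramer_coeff n ?z i l * cramer_coeff n ?z j k) / (D * D)" for i j k l
      by (simp add: B_def diff_divide_distrib)
    then show ?thesis
      using gen D unfolding generic_matrix_def by (simp add: B_def)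
  qed
  then have "adapted_frames n A T B"
    using assms(1) A A_T T_A second by unfold_locales
  then show ?thesis by (rule that)
qed

text \<open>For \<open>B\<^sub>i\<^sub>k = 1 + i k\<close> the minors in question are \<open>(i - j) (k - l)\<close>; characteristic zero keeps them and
the entries away from zero.\<close>
lemma genericity_nonzero_example:
  "genericity n (\<lambda>(i, r, c). if r = 0 then (if i = c then 1 else 0) else 1 + of_nat (i * c)) \<noteq>
     (0 :: 'k::field_char_0)"
  (is "genericity n ?z \<noteq> 0")
proof -
  have a: "first_rows n ?z = 1\<^sub>m (Suc n)"
    by (intro eq_matI) (auto simp: first_rows_def)
  have "cofactor (first_rows n ?z) k c = (if k = c then 1 else 0)" if "k \<le> n" "c \<le> n" for k c
  proof -
    have "cofactor (first_rows n ?z) k c =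
        (\<Sum>d\<le>n. if d = c then cofactor (first_rows n ?z) k d else 0)"
      using that by simp
    also have "\<dots> = (\<Sum>d\<le>n. ?z (c, 0, d) * cofactor (first_rows n ?z) k d)"
      by (intro sum.cong) auto
    also have "\<dots> = (if c = k then 1 else 0)"
      by (subst first_rows_cofactors(1)) (use that a in auto)
    finally show ?thesis by auto
  qed
  then have cramer: "cramer_coeff n ?z i k = of_nat (1 + i * k)" if "k \<le> n" for i k
  proof -
    have "cramer_coeff n ?z i k = (\<Sum>c\<le>n. if c = k then of_nat (1 + i * c) else 0)"
      unfolding cramer_coeff_def using that \<open>\<And>k c. k \<le> n \<Longrightarrow> c \<le> n \<Longrightarrow> _\<close>
      by (intro sum.cong) auto
    then show ?thesis using that by simp
  qed
  have "generic_matrix n (cramer_coeff n ?z)"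
    unfolding generic_matrix_def
  proof (intro conjI allI impI)
    fix i k assume "i \<le> n" "k \<le> n"
    then show "cramer_coeff n ?z i k \<noteq> 0"
      by (simp add: cramer del: of_nat_add of_nat_mult of_nat_Suc)
  next
    fix i j k l assume le: "i \<le> n" "j \<le> n" "k \<le> n" "l \<le> n" and dist: "distinct [i, j, k, l]"
    have "cramer_coeff n ?z i k * cramer_coeff n ?z j l - cramer_coeff n ?z i l * cramer_coeff n ?z j k =
        (of_nat i - of_nat j) * (of_nat k - of_nat l)"
      using le by (simp add: cramer algebra_simps)
    also have "\<dots> \<noteq> 0"
      using dist by simp
    finally show "cramer_coeff n ?z i k * cramer_coeff n ?z j l -
        cramer_coeff n ?z i l * cramer_coeff n ?z j k \<noteq> 0" .
  qed
  then show ?thesis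
    unfolding genericity_nonzero_iff by (simp add: a)
qed

section \<open>The open dense set of generic configurations\<close>

text \<open>It suffices that one choice of frames is generic, since whether \<open>genericity\<close> vanishes is not
determined by the configuration.\<close>
definition generic_configs :: "nat \<Rightarrow> (nat \<Rightarrow> 'k::field pt set) set" where
  "generic_configs n = {config_of n A | A. A \<in> config_frames n \<and> genericity n (entries A) \<noteq> 0}"

lemma config_of_in_configs: "A \<in> config_frames n \<Longrightarrow> config_of n A \<in> configs n"
  by (auto simp: config_frames_def configs_def config_of_def codim2_subspaces_def PiE_def Pi_def)

lemma configs_framed:
  assumes "P \<in> configs n"
  obtains A where "A \<in> config_frames n" "config_of n A = P"
proof -
  have "\<forall>i\<in>{..n}. \<exists>M. M \<in> frames2 n \<and> P i = lin_subspace n M"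
    using assms by (auto simp: configs_def codim2_subspaces_def)
  then obtain A where A: "\<And>i. i \<le> n \<Longrightarrow> A i \<in> frames2 n \<and> P i = lin_subspace n (A i)"
    by (metis atMost_iff)
  show ?thesis
  proof (rule that[of "restrict A {..n}"])
    show "restrict A {..n} \<in> config_frames n"
      using A by (auto simp: config_frames_def)
    show "config_of n (restrict A {..n}) = P"
      using A assms by (auto simp: config_of_def configs_def PiE_def extensional_def fun_eq_iff)
  qed
qed

definition frames_of_entries :: "nat \<Rightarrow> (nat \<times> nat \<times> nat \<Rightarrow> 'k) \<Rightarrow> nat \<Rightarrow> 'k mat" where
  "frames_of_entries n z = (\<lambda>i\<in>{..n}. mat 2 (Suc n) (\<lambda>(r, c). z (i, r, c)))"

lemma entries_frames_of_entries:
  "v \<in> frame_coords n \<Longrightarrow> entries (frames_of_entries n z) v = z v"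
  by (auto simp: entries_def frames_of_entries_def)

lemma genericity_frames_of_entries: "genericity n (entries (frames_of_entries n z)) = genericity n z"
  by (rule genericity_cong) (rule entries_frames_of_entries)

definition frame_change :: "(nat \<Rightarrow> nat \<Rightarrow> nat \<Rightarrow> 'k::comm_ring_1) \<Rightarrow>
    (nat \<times> nat \<times> nat \<Rightarrow> 'k) \<Rightarrow> nat \<times> nat \<times> nat \<Rightarrow> 'k" where
  "frame_change m z = (\<lambda>(i, r, c). row_change (m i) (\<lambda>r c. z (i, r, c)) r c)"

lemma config_of_frame_change:
  fixes A :: "nat \<Rightarrow> 'k::field mat"
  assumes A: "A \<in> config_frames n" and m: "\<And>i. i \<le> n \<Longrightarrow> det2 (m i) \<noteq> 0"
  defines "A' \<equiv> frames_of_entries n (frame_change m (entries A))"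
  shows "A' \<in> config_frames n" "config_of n A' = config_of n A"
proof -
  have row: "A' i $$ (r, c) = row_change (m i) (\<lambda>r c. A i $$ (r, c)) r c"
    if "i \<le> n" "r < 2" "c \<le> n" for i r c
    using that by (simp add: A'_def frames_of_entries_def frame_change_def entries_apply)
  have carr: "A' i \<in> carrier_mat 2 (Suc n)" if "i \<le> n" for i
    using that by (simp add: A'_def frames_of_entries_def)
  have Ai: "A i \<in> frames2 n" if "i \<le> n" for i
    using A that by (auto simp: config_frames_def)
  have "A' i \<in> frames2 n" if i: "i \<le> n" for i
  proof -
    obtain p q where "p \<le> n" "q \<le> n" "minor2 (A i) p q \<noteq> 0"
      using Ai[OF i] by (auto simp: frames2_iff)
    moreover from this have "minor2 (A' i) p q = det2 (m i) * minor2 (A i) p q"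
      using row[OF i] by (intro minor2_row_change) auto
    ultimately show ?thesis
      unfolding frames2_iff using carr[OF i] m[OF i] by (metis mult_eq_0_iff)
  qed
  then show "A' \<in> config_frames n"
    by (auto simp: config_frames_def A'_def frames_of_entries_def)
  have "lin_subspace n (A' i) = lin_subspace n (A i)" if "i \<le> n" for i
    using Ai[OF that] carr[OF that] row[OF that] m[OF that]
    by (intro lin_subspace_row_change[of "A i" n "A' i" "m i"]) (auto simp: frames2_def)
  then show "config_of n A' = config_of n A"
    unfolding config_of_def by (intro restrict_ext) auto
qed

lemma config_of_eq_frame_change:
  fixes A A' :: "nat \<Rightarrow> 'k::field mat"
  assumes A: "A \<in> config_frames n" "A' \<in> config_frames n" "config_of n A = config_of n A'"
  obtains m where "\<And>i. i \<le> n \<Longrightarrow> det2 (m i) \<noteq> 0"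
    "\<And>v. v \<in> frame_coords n \<Longrightarrow> entries A' v = frame_change m (entries A) v"
proof -
  have "\<exists>m. det2 m \<noteq> 0 \<and> (\<forall>r<2. \<forall>c\<le>n. A' i $$ (r, c) = row_change m (\<lambda>r c. A i $$ (r, c)) r c)"
    if i: "i \<le> n" for i
  proof -
    have sub: "lin_subspace n (A i) \<subseteq> lin_subspace n (A' i)"
      using fun_cong[OF A(3), of i] i by (simp add: config_of_def)
    have fr: "A i \<in> frames2 n" "A' i \<in> frames2 n"
      using A i by (auto simp: config_frames_def)
    show ?thesis
      by (rule row_change_if_lin_subspace_subset[OF fr sub]) auto
  qed
  then obtain m where m: "\<And>i. i \<le> n \<Longrightarrow> det2 (m i) \<noteq> 0"
    "\<And>i r c. i \<le> n \<Longrightarrow> r < 2 \<Longrightarrow> c \<le> n \<Longrightarrow>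
        A' i $$ (r, c) = row_change (m i) (\<lambda>r c. A i $$ (r, c)) r c"
    by metis
  show ?thesis
    by (rule that[of m]) (auto simp: m frame_change_def entries_apply)
qed

text \<open>The frames of generic configurations are those which some change of frames
makes generic. For each fixed change this is the nonvanishing of one polynomial in the entries, and the
family of these polynomials describes the preimage.\<close>
lemma zariski_open_generic_configs:
  "zariski_open n (generic_configs n :: (nat \<Rightarrow> 'k::field pt set) set)"
  unfolding zariski_open_def
proof (intro conjI exI)
  show "generic_configs n \<subseteq> (configs n :: (nat \<Rightarrow> 'k pt set) set)"
    by (auto simp: generic_configs_def config_of_in_configs)
  define G where "G = {h \<in> mpols_in (frame_coords n).
    \<exists>m :: nat \<Rightarrow> nat \<Rightarrow> nat \<Rightarrow> 'k. (\<forall>i\<le>n. det2 (m i) \<noteq> 0) \<and>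
      (\<forall>z. mpol_eval id z h = genericity n (frame_change m z))}"
  show "G \<subseteq> mpols_in (frame_coords n)"
    by (auto simp: G_def)
  have "config_of n A \<in> generic_configs n \<longleftrightarrow> (\<exists>h\<in>G. mpol_eval id (entries A) h \<noteq> 0)"
    if A: "A \<in> config_frames n" for A :: "nat \<Rightarrow> 'k mat"
  proof
    assume "config_of n A \<in> generic_configs n"
    then obtain A' where A': "A' \<in> config_frames n" "config_of n A = config_of n A'"
      "genericity n (entries A') \<noteq> 0"
      by (auto simp: generic_configs_def)
    obtain m where m: "\<And>i. i \<le> n \<Longrightarrow> det2 (m i) \<noteq> 0"
      "\<And>v. v \<in> frame_coords n \<Longrightarrow> entries A' v = frame_change m (entries A) v"
      using config_of_eq_frame_change[OF A A'(1,2)] by blast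
    have "polyfun (frame_coords n) (\<lambda>z. genericity n (frame_change m z))"
      by (rule polyfun_genericity)
         (auto simp: frame_change_def row_change_def
           intro!: polyfun_add polyfun_mult polyfun_const polyfun_var)
    then obtain h where h: "h \<in> mpols_in (frame_coords n)"
      "\<And>z. genericity n (frame_change m z) = mpol_eval id z h"
      by (auto simp: polyfun_def)
    have "h \<in> G"
      using h m(1) by (auto simp: G_def intro!: exI[of _ m])
    moreover have "mpol_eval id (entries A) h \<noteq> 0"
      using A'(3) genericity_cong[OF m(2)] by (simp flip: h(2))
    ultimately show "\<exists>h\<in>G. mpol_eval id (entries A) h \<noteq> 0" by blast
  next
    assume "\<exists>h\<in>G. mpol_eval id (entries A) h \<noteq> 0"
    then obtain h m where "\<forall>i\<le>n. det2 (m i) \<noteq> 0" "mpol_eval id (entries A) h \<noteq> 0"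
      "\<forall>z. mpol_eval id z h = genericity n (frame_change m z)"
      unfolding G_def by blast
    then have m: "\<And>i. i \<le> n \<Longrightarrow> det2 (m i) \<noteq> 0" "genericity n (frame_change m (entries A)) \<noteq> 0"
      by auto
    define A' where "A' = frames_of_entries n (frame_change m (entries A))"
    have "genericity n (entries A') \<noteq> 0"
      using m(2) by (simp add: A'_def genericity_frames_of_entries)
    moreover have "A' \<in> config_frames n" "config_of n A' = config_of n A"
      using config_of_frame_change[OF A, of m] m(1) by (auto simp: A'_def)
    ultimately show "config_of n A \<in> generic_configs n"
      unfolding generic_configs_def mem_Collect_eq by (intro exI[of _ A']) simp
  qed
  then show "{A \<in> config_frames n. config_of n A \<in> (generic_configs n :: (nat \<Rightarrow> 'k pt set) set)} =
      {A \<in> config_frames n. \<exists>g\<in>G. mpol_eval id (\<lambda>(i, r, c). A i $$ (r, c)) g \<noteq> 0}"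
    unfolding entries_def by blast
qed

text \<open>A nonempty open \<open>W\<close> contains a configuration with frames \<open>A\<close> at which one of the polynomials
describing \<open>W\<close> is nonzero. Multiplied by minors that certify that the entries of \<open>A\<close> are frames, it still
has a common point of nonvanishing with \<open>genericity\<close>.\<close>
lemma zariski_dense_generic_configs:
  "zariski_dense n (generic_configs n :: (nat \<Rightarrow> 'k::field_char_0 pt set) set)"
  unfolding zariski_dense_def
proof (intro allI impI, elim conjE)
  fix W :: "(nat \<Rightarrow> 'k pt set) set"
  assume W: "zariski_open n W" "W \<noteq> {}"
  then obtain H :: "(nat \<times> nat \<times> nat, 'k) mpol set" where
    H: "H \<subseteq> mpols_in (frame_coords n)"
      "\<And>A. A \<in> config_frames n \<Longrightarrow> config_of n A \<in> W \<longleftrightarrow> (\<exists>h\<in>H. mpol_eval id (entries A) h \<noteq> 0)"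
    unfolding zariski_open_def entries_def by blast
  obtain P where P: "P \<in> W" "P \<in> configs n"
    using W by (auto simp: zariski_open_def)
  obtain A where A: "A \<in> config_frames n" "config_of n A = P"
    using P(2) by (rule configs_framed)
  obtain h where h: "h \<in> H" "mpol_eval id (entries A) h \<noteq> 0"
    using H(2)[OF A(1)] A(2) P(1) by blast
  have "A i \<in> frames2 n" if "i \<le> n" for i
    using A(1) that by (auto simp: config_frames_def)
  then have "\<exists>p q. p \<le> n \<and> q \<le> n \<and> minor2 (A i) p q \<noteq> 0" if "i \<le> n" for i
    using that unfolding frames2_iff by blast
  then obtain p q where pq: "\<And>i. i \<le> n \<Longrightarrow> p i \<le> n \<and> q i \<le> n \<and> minor2 (A i) (p i) (q i) \<noteq> 0"
    by metis
  define F where "F z = mpol_eval id z h *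
    (\<Prod>i\<le>n. z (i, 0, p i) * z (i, 1, q i) - z (i, 0, q i) * z (i, 1, p i))" for z
  have "polyfun (frame_coords n) (\<lambda>z. mpol_eval id z h)"
    using h(1) H(1) by (auto simp: polyfun_def)
  then have F: "polyfun (frame_coords n) F"
    unfolding F_def using pq
    by (intro polyfun_mult polyfun_prod polyfun_diff polyfun_var) auto
  have gen: "polyfun (frame_coords n) (genericity n :: (_ \<Rightarrow> 'k) \<Rightarrow> 'k)"
    by (rule polyfun_genericity[of n "frame_coords n" "\<lambda>z. z"]) (rule polyfun_var)
  have nz: "F (entries A) \<noteq> 0"
    using h(2) pq by (simp add: F_def entries_apply minor2_def)
  obtain u where u: "F u \<noteq> 0" "genericity n u \<noteq> 0"
    by (rule polyfun_common_nonzero[where F = F and G = "genericity n", OF F gen nz genericity_nonzero_example])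
  define A' where "A' = frames_of_entries n u"
  have u_A': "entries A' v = u v" if "v \<in> frame_coords n" for v
    using that by (simp add: A'_def entries_frames_of_entries)
  have "A' i \<in> frames2 n" if i: "i \<le> n" for i
  proof -
    have "minor2 (A' i) (p i) (q i) \<noteq> 0"
      using u(1) i pq[OF i] by (simp add: F_def A'_def frames_of_entries_def minor2_def)
    then show ?thesis
      using i pq[OF i] by (auto simp: frames2_iff A'_def frames_of_entries_def)
  qed
  then have A': "A' \<in> config_frames n"
    by (auto simp: config_frames_def A'_def frames_of_entries_def)
  have "mpol_eval id (entries A') h = mpol_eval id u h"
    using h(1) H(1) u_A' by (intro mpol_eval_cong[of h "frame_coords n"]) auto
  then have "mpol_eval id (entries A') h \<noteq> 0"
    using u(1) by (simp add: F_def)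
  then have "config_of n A' \<in> W"
    using H(2)[OF A'] h(1) by blast
  moreover have "config_of n A' \<in> generic_configs n"
    using A' u(2) by (auto simp: generic_configs_def A'_def genericity_frames_of_entries)
  ultimately show "generic_configs n \<inter> W \<noteq> {}"
    by blast
qed

theorem proposition3p2:
  fixes n :: nat
  assumes "n \<ge> 2"
  shows "\<exists>U :: (nat \<Rightarrow> ('k::field_char_0) pt set) set.
           zariski_open n U \<and> zariski_dense n U \<and>
           (\<forall>P\<in>U. base_locus n P = (\<Union>i\<le>n. P i) \<union> R_locus n P)"
proof (intro exI conjI ballI)
  show "zariski_open n (generic_configs n :: (nat \<Rightarrow> 'k pt set) set)"
    by (rule zariski_open_generic_configs)
  show "zariski_dense n (generic_configs n :: (nat \<Rightarrow> 'k pt set) set)"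
    by (rule zariski_dense_generic_configs)
  fix P :: "nat \<Rightarrow> 'k pt set" assume "P \<in> generic_configs n"
  then obtain A where A: "P = config_of n A" "A \<in> config_frames n" "genericity n (entries A) \<noteq> 0"
    by (auto simp: generic_configs_def)
  have "A i \<in> carrier_mat 2 (Suc n)" if "i \<le> n" for i
    using A(2) that by (auto simp: config_frames_def frames2_def)
  then obtain T B where "adapted_frames n A T B"
    using adapted_frames_if_genericity[OF assms _ A(3)] by blast
  then show "base_locus n P = (\<Union>i\<le>n. P i) \<union> R_locus n P"
    by (rule adapted_frames.base_locus_eq) (simp add: A(1) config_of_def)
qed

end
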